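(* Fix $k\ge 2$. Let $\pi$ be a permutation containing a decreasing subsequence of length $k$, for which the A-sequence and the B-sequence do not coincide. Then $\phi(\pi)$ and $\psi(\pi)$ still contain a decreasing subsequence of length $k$, and $\phi(\psi(\pi))=\psi(\phi(\pi))$.
   Context: Letters of $\pi=\pi_1\cdots\pi_n$ are identified with their values; "$x$ precedes $y$" means $x$ is at a smaller position. The A-sequence $A(\pi)=a_k\cdots a_1$ is the lexicographically smallest (as a sequence of values read left to right) decreasing subsequence of $\pi$ of length $k$. The B-sequence $B(\pi)=b_k\cdots b_1$ is defined recursively: $b_1$ is the leftmost letter that is the last letter of a decreasing subsequence of length $k$, and for $j\ge 2$, $b_j$ is the leftmost letter such that $b_jb_{j-1}\cdots b_1$ is a suffix of a decreasing subsequence of length $k$. The A-shift $\phi(\pi)$ is obtained by moving, for $m=k,\ldots,2$, the letter $a_{m-1}$ to the position previously occupied by $a_m$, and moving $a_k$ to the position previously occupied by $a_1$ (other letters fixed); $\phi(\pi)=\pi$ if $\pi$ has no decreasing subsequence of length $k$. The B-shift $\psi(\pi)$ is defined in the same way using the B-sequence. *)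

theory Defs
  imports
    "HOL-Library.Sublist"
    "HOL-Library.List_Lexorder"
    "HOL-Combinatorics.Cycles"
    "HOL-Combinatorics.Multiset_Permutations"
begin

text \<open>
  Permutations are words in one-line notation, as in \<^const>\<open>permutations_of_set\<close>. A subsequence
  is given by its list of letters, read from left to right; so the list for
  $a_k a_{k-1} \cdots a_1$ has $a_k$ at index 0 and $a_1$ at index $k - 1$.
\<close>

definition dec_subseqs :: "nat \<Rightarrow> nat list \<Rightarrow> nat list set" where
  "dec_subseqs k \<pi> = {xs. subseq xs \<pi> \<and> sorted_wrt (>) xs \<and> length xs = k}"

lemma finite_dec_subseqs: "finite (dec_subseqs k \<pi>)"
  by (rule finite_subset[of _ "set (subseqs \<pi>)"]) (auto simp: dec_subseqs_def)

text \<open>The minimum is with respect to the lexicographic order on lists.\<close>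

definition A_seq :: "nat \<Rightarrow> nat list \<Rightarrow> nat list" where
  "A_seq k \<pi> = Min (dec_subseqs k \<pi>)"

definition leftmost :: "(nat \<Rightarrow> bool) \<Rightarrow> nat list \<Rightarrow> nat" where
  "leftmost P \<pi> = hd (filter P \<pi>)"

text \<open>
  \<open>B_suffix k \<pi> j\<close> is $b_j \cdots b_1$. The step from \<open>0\<close> to \<open>1\<close> chooses $b_1$, since
  \<open>[b]\<close> is a suffix of \<open>xs\<close> iff \<open>b\<close> is the last letter of \<open>xs\<close>.
\<close>

primrec B_suffix :: "nat \<Rightarrow> nat list \<Rightarrow> nat \<Rightarrow> nat list" where
  "B_suffix k \<pi> 0 = []"
| "B_suffix k \<pi> (Suc j) =
     leftmost (\<lambda>b. \<exists>xs \<in> dec_subseqs k \<pi>. suffix (b # B_suffix k \<pi> j) xs) \<pi> # B_suffix k \<pi> j"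

definition B_seq :: "nat \<Rightarrow> nat list \<Rightarrow> nat list" where
  "B_seq k \<pi> = B_suffix k \<pi> k"

text \<open>
  \<open>shift s \<pi>\<close> puts, at the position of each letter of \<open>s\<close>, the next letter of \<open>s\<close>, and
  at the position of the last letter of \<open>s\<close> its first letter; see \<open>nth_shift\<close>.
\<close>

definition shift :: "nat list \<Rightarrow> nat list \<Rightarrow> nat list" where
  "shift s \<pi> = map (cycle_of_list s) \<pi>"

lemma nth_shift:
  assumes "distinct s" "i < length \<pi>" "j < length s" "\<pi> ! i = s ! j"
  shows "shift s \<pi> ! i = s ! (Suc j mod length s)"
proof -
  have "map (cycle_of_list s) s = rotate1 s"
    using cyclic_rotation[OF assms(1), of 1] by simp
  then have "cycle_of_list s (s ! j) = rotate1 s ! j"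
    using assms(3) by (metis nth_map)
  then show ?thesis
    using assms by (simp add: shift_def nth_rotate1)
qed

lemma nth_shift_other:
  "i < length \<pi> \<Longrightarrow> \<pi> ! i \<notin> set s \<Longrightarrow> shift s \<pi> ! i = \<pi> ! i"
  by (simp add: shift_def id_outside_supp)

definition A_shift :: "nat \<Rightarrow> nat list \<Rightarrow> nat list" where
  "A_shift k \<pi> = (if dec_subseqs k \<pi> = {} then \<pi> else shift (A_seq k \<pi>) \<pi>)"

definition B_shift :: "nat \<Rightarrow> nat list \<Rightarrow> nat list" where
  "B_shift k \<pi> = (if dec_subseqs k \<pi> = {} then \<pi> else shift (B_seq k \<pi>) \<pi>)"

end

theory Submission
  imports Defs
begin

text \<open>
  View \<open>\<pi>\<close> as the set of points (position, value), so that decreasing subsequences are chains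
  running south-east and passing to the inverse permutation swaps the two coordinates. This swap
  exchanges A and B, hence each statement about one of the shifts gives one about the other.

  At every position left of $a_1$, the longest chain ending there does not get longer under the
  A-shift. If A and B are disjoint, then B is still the B-sequence of $\phi(\pi)$, and dually, so the
  two cycles commute. Otherwise A and B share a block $a_{r+d} = b_r$, $p \le r \le q$, with $d > 0$,
  since a letter $a_i = b_i$ would force A = B. Then B of $\phi(\pi)$ has the letters
  $b_k \cdots b_{q+1}\, e_{q-1} \cdots e_p\, a_{p+d-1}\, b_{p-1} \cdots b_1$, and A of $\psi(\pi)$ has the
  letters $a_k \cdots a_{q+d}\, e'_{q-1} \cdots e'_p\, a_{p+d-1} \cdots a_1$, where each $e_r$ is the old
  letter $b_r$ or lies outside A and B. Both middle parts are greedy choices between the same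
  end points, one from below and one from above, and their points have the same rank, so
  $e_r = e'_r$. The identity of permutations follows letter by letter.
\<close>

text \<open>Exact ranks carry the argument. If a longer chain started at a point of A, its second
  point would have been a smaller choice for that point (\<open>is_A_not_down\<close>); dually for
  chains ending at a point of B (\<open>is_B_not_up\<close>). Points of equal exact rank are
  incomparable, so for them a comparison of values can be traded for one of positions, and every
  greedy comparison of two chains rests on this trade.

  The obstacle is that lowering letters creates new inversions. The rank estimate after the A-shift
  therefore compares a new point with the old point at the same position, and is proved together
  with a second claim on unmoved points. It stops at \<open>a 0\<close>, where the wrapped letter is
  raised instead of lowered; B lies to the left of \<open>a 0\<close> as soon as the last letters
  differ. Only at the upper end of the common block does the estimate leave a rival of
  \<open>b (Suc q)\<close> alive, an unmoved point below \<open>b q\<close>. The second claim trades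
  it for the letter of A that follows the block upwards, and this letter would have to be
  \<open>b (Suc q)\<close>, one common letter too many.\<close>

declare split_paired_All [simp del] split_paired_Ex [simp del]

subsection \<open>Chains of points\<close>

type_synonym point = "nat \<times> nat"

definition nw :: "point \<Rightarrow> point \<Rightarrow> bool" (infix "\<rhd>" 50) where
  "x \<rhd> y \<longleftrightarrow> fst x < fst y \<and> snd y < snd x"

lemma nw_trans: "x \<rhd> y \<Longrightarrow> y \<rhd> z \<Longrightarrow> x \<rhd> z"
  by (auto simp: nw_def)

lemma nw_swap [simp]: "prod.swap x \<rhd> prod.swap y \<longleftrightarrow> y \<rhd> x"
  by (auto simp: nw_def)

text \<open>The index counts links, so \<open>down S m x\<close> speaks of chains of \<open>m + 1\<close> points.\<close>

primrec down :: "point set \<Rightarrow> nat \<Rightarrow> point \<Rightarrow> bool" where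
  "down S 0 x \<longleftrightarrow> x \<in> S"
| "down S (Suc m) x \<longleftrightarrow> x \<in> S \<and> (\<exists>y. x \<rhd> y \<and> down S m y)"

primrec up :: "point set \<Rightarrow> nat \<Rightarrow> point \<Rightarrow> bool" where
  "up S 0 x \<longleftrightarrow> x \<in> S"
| "up S (Suc m) x \<longleftrightarrow> x \<in> S \<and> (\<exists>y. y \<rhd> x \<and> up S m y)"

lemma down_in: "down S m x \<Longrightarrow> x \<in> S"
  by (cases m) auto

lemma up_in: "up S m x \<Longrightarrow> x \<in> S"
  by (cases m) auto

lemma swap_swap_image [simp]: "prod.swap ` prod.swap ` S = S"
  by (simp add: image_comp)

lemma swap_mem_image [simp]: "prod.swap x \<in> prod.swap ` S \<longleftrightarrow> x \<in> S"
  by (metis image_iff swap_swap)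

lemma down_swap [simp]: "down (prod.swap ` S) m (prod.swap x) \<longleftrightarrow> up S m x"
proof (induction m arbitrary: x)
  case (Suc m)
  have "(\<exists>y. prod.swap x \<rhd> y \<and> down (prod.swap ` S) m y) \<longleftrightarrow> (\<exists>y. y \<rhd> x \<and> up S m y)"
    using Suc nw_swap by (metis swap_swap)
  then show ?case
    by simp
qed simp

lemma up_swap [simp]: "up (prod.swap ` S) m (prod.swap x) \<longleftrightarrow> down S m x"
  by (metis down_swap swap_swap swap_swap_image)

lemma down_Suc: "x \<in> S \<Longrightarrow> x \<rhd> y \<Longrightarrow> down S m y \<Longrightarrow> down S (Suc m) x"
  by auto

lemma up_Suc: "x \<in> S \<Longrightarrow> y \<rhd> x \<Longrightarrow> up S m y \<Longrightarrow> up S (Suc m) x"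
  by auto

lemma down_SucD: "down S (Suc m) x \<Longrightarrow> down S m x"
proof (induction m arbitrary: x)
  case (Suc m)
  then show ?case
    by (metis down.simps(2))
qed simp

lemma up_SucD: "up S (Suc m) x \<Longrightarrow> up S m x"
proof (induction m arbitrary: x)
  case (Suc m)
  then show ?case
    by (metis up.simps(2))
qed simp

declare down.simps(2) [simp del] up.simps(2) [simp del]

lemma down_mono: "down S n x \<Longrightarrow> m \<le> n \<Longrightarrow> down S m x"
  by (induction n) (use down_SucD le_Suc_eq in blast)+

lemma up_mono: "up S n x \<Longrightarrow> m \<le> n \<Longrightarrow> up S m x"
  by (induction n) (use up_SucD le_Suc_eq in blast)+

text \<open>Positions need not form an interval: finiteness and injectivity of both coordinates are
  all that is kept of a permutation, and these conditions are symmetric under the swap.\<close>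

definition placement :: "point set \<Rightarrow> bool" where
  "placement S \<longleftrightarrow> finite S \<and> inj_on fst S \<and> inj_on snd S"

lemma placement_swap [simp]: "placement (prod.swap ` S) \<longleftrightarrow> placement S"
proof -
  have "placement (prod.swap ` S)" if "placement S" for S
    using that by (auto simp: placement_def inj_on_def)
  then show ?thesis
    by (metis swap_swap_image)
qed

lemma fst_eqD: "placement S \<Longrightarrow> x \<in> S \<Longrightarrow> y \<in> S \<Longrightarrow> fst x = fst y \<Longrightarrow> x = y"
  by (auto simp: placement_def inj_on_def)

lemma snd_eqD: "placement S \<Longrightarrow> x \<in> S \<Longrightarrow> y \<in> S \<Longrightarrow> snd x = snd y \<Longrightarrow> x = y"
  by (auto simp: placement_def inj_on_def)

definition chain :: "nat \<Rightarrow> (nat \<Rightarrow> point) \<Rightarrow> bool" where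
  "chain K c \<longleftrightarrow> (\<forall>i<K. c (Suc i) \<rhd> c i)"

lemma chain_nw: "chain K c \<Longrightarrow> i < j \<Longrightarrow> j \<le> K \<Longrightarrow> c j \<rhd> c i"
proof (induction j)
  case (Suc j)
  then show ?case
    unfolding chain_def by (metis Suc_le_eq less_Suc_eq nw_trans order_less_imp_le)
qed simp

lemma chain_eq: "chain K c \<Longrightarrow> i \<le> K \<Longrightarrow> j \<le> K \<Longrightarrow> c i = c j \<longleftrightarrow> i = j"
  by (metis chain_nw linorder_neqE_nat nw_def order_less_irrefl)

lemma chain_fst_less: "chain K c \<Longrightarrow> i \<le> K \<Longrightarrow> j \<le> K \<Longrightarrow> fst (c i) < fst (c j) \<longleftrightarrow> j < i"
  by (metis chain_nw less_not_sym linorder_neqE_nat nw_def order_less_irrefl)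

lemma chain_snd_less: "chain K c \<Longrightarrow> i \<le> K \<Longrightarrow> j \<le> K \<Longrightarrow> snd (c i) < snd (c j) \<longleftrightarrow> i < j"
  by (metis chain_nw less_not_sym linorder_neqE_nat nw_def order_less_irrefl)

lemma down_chain: "chain K c \<Longrightarrow> c ` {..K} \<subseteq> S \<Longrightarrow> down S m (c i) \<Longrightarrow> i + n \<le> K \<Longrightarrow> down S (m + n) (c (i + n))"
proof (induction n)
  case (Suc n)
  then have "down S (m + n) (c (i + n))" "c (Suc (i + n)) \<rhd> c (i + n)" "c (Suc (i + n)) \<in> S"
    by (auto simp: chain_def)
  then show ?case
    using down_Suc by simp
qed simp

lemma up_chain: "chain K c \<Longrightarrow> c ` {..K} \<subseteq> S \<Longrightarrow> up S m (c (i + n)) \<Longrightarrow> i + n \<le> K \<Longrightarrow> up S (m + n) (c i)"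
proof (induction n arbitrary: m)
  case (Suc n)
  have "up S (Suc m) (c (i + n))"
    using Suc.prems by (intro up_Suc[where y="c (i + Suc n)"]) (auto simp: chain_def)
  from Suc.IH[OF Suc.prems(1,2) this] show ?case
    using Suc.prems by simp
qed simp

text \<open>
  Indices start at 0: \<open>a i\<close> is the point of the letter $a_{i+1}$, and \<open>K\<close> is $k - 1$.
\<close>

definition is_A :: "point set \<Rightarrow> nat \<Rightarrow> (nat \<Rightarrow> point) \<Rightarrow> bool" where
  "is_A S K a \<longleftrightarrow> chain K a \<and> a ` {..K} \<subseteq> S \<and>
     (\<forall>x. down S K x \<longrightarrow> snd (a K) \<le> snd x) \<and>
     (\<forall>m<K. \<forall>x. down S m x \<longrightarrow> fst (a (Suc m)) < fst x \<longrightarrow> snd (a m) \<le> snd x)"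

text \<open>As in \<open>is_A\<close>, a candidate \<open>x\<close> is compared with the previous
  letter in one coordinate only. On the wrong side in the other coordinate it satisfies the required
  inequality anyway, because \<open>b\<close> is a chain.\<close>

definition is_B :: "point set \<Rightarrow> nat \<Rightarrow> (nat \<Rightarrow> point) \<Rightarrow> bool" where
  "is_B S K b \<longleftrightarrow> chain K b \<and> b ` {..K} \<subseteq> S \<and>
     (\<forall>x. up S K x \<longrightarrow> fst (b 0) \<le> fst x) \<and>
     (\<forall>j<K. \<forall>x. up S (K - Suc j) x \<longrightarrow> snd (b j) < snd x \<longrightarrow> fst (b (Suc j)) \<le> fst x)"

lemma is_A_chain: "is_A S K a \<Longrightarrow> chain K a"
  and is_A_mem: "is_A S K a \<Longrightarrow> i \<le> K \<Longrightarrow> a i \<in> S"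
  and is_A_image: "is_A S K a \<Longrightarrow> a ` {..K} \<subseteq> S"
  and is_A_top: "is_A S K a \<Longrightarrow> down S K x \<Longrightarrow> snd (a K) \<le> snd x"
  and is_A_step: "is_A S K a \<Longrightarrow> m < K \<Longrightarrow> down S m x \<Longrightarrow> fst (a (Suc m)) < fst x \<Longrightarrow> snd (a m) \<le> snd x"
  by (auto simp: is_A_def)

lemma is_B_chain: "is_B S K b \<Longrightarrow> chain K b"
  and is_B_mem: "is_B S K b \<Longrightarrow> i \<le> K \<Longrightarrow> b i \<in> S"
  and is_B_image: "is_B S K b \<Longrightarrow> b ` {..K} \<subseteq> S"
  and is_B_bot: "is_B S K b \<Longrightarrow> up S K x \<Longrightarrow> fst (b 0) \<le> fst x"
  and is_B_step: "is_B S K b \<Longrightarrow> j < K \<Longrightarrow> up S (K - Suc j) x \<Longrightarrow> snd (b j) < snd x \<Longrightarrow> fst (b (Suc j)) \<le> fst x"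
  by (auto simp: is_B_def)

text \<open>Inverting the permutation turns a B-sequence into an A-sequence read backwards.\<close>

definition dual :: "nat \<Rightarrow> (nat \<Rightarrow> point) \<Rightarrow> nat \<Rightarrow> point" where
  "dual K c i = prod.swap (c (K - i))"

lemma chain_dual: "chain K c \<Longrightarrow> chain K (dual K c)"
  unfolding chain_def dual_def nw_swap
proof (intro allI impI)
  fix i assume c: "\<forall>i<K. c (Suc i) \<rhd> c i" and i: "i < K"
  then have "c (Suc (K - Suc i)) \<rhd> c (K - Suc i)"
    by simp
  then show "c (K - i) \<rhd> c (K - Suc i)"
    using i by (simp add: Suc_diff_Suc)
qed

lemma image_dual: "dual K c ` {..K} = prod.swap ` c ` {..K}"
proof -
  have "{..K} = (\<lambda>i. K - i) ` {..K}"
  proof (intro equalityI subsetI)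
    fix i assume "i \<in> {..K}"
    then show "i \<in> (\<lambda>i. K - i) ` {..K}"
      by (intro image_eqI[of _ _ "K - i"]) auto
  qed auto
  then have "c ` {..K} = (\<lambda>i. c (K - i)) ` {..K}"
    by (metis (no_types, lifting) image_cong image_image)
  then show ?thesis
    by (simp add: dual_def image_image)
qed

lemma is_B_dual:
  assumes "is_A S K a"
  shows "is_B (prod.swap ` S) K (dual K a)"
proof -
  have "fst (dual K a (Suc j)) \<le> fst x"
    if "j < K" "up (prod.swap ` S) (K - Suc j) x" "snd (dual K a j) < snd x" for j x
  proof -
    have "down S (K - Suc j) (prod.swap x)"
      using that(2) by (metis up_swap swap_swap)
    moreover have "fst (a (Suc (K - Suc j))) < fst (prod.swap x)"
      using that(1,3) by (simp add: dual_def Suc_diff_Suc)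
    ultimately have "snd (a (K - Suc j)) \<le> snd (prod.swap x)"
      using that(1) by (intro is_A_step[OF assms]) auto
    then show ?thesis
      by (simp add: dual_def)
  qed
  moreover have "fst (dual K a 0) \<le> fst x" if "up (prod.swap ` S) K x" for x
  proof -
    have "down S K (prod.swap x)"
      using that by (metis up_swap swap_swap)
    then show ?thesis
      using assms by (auto simp: is_A_def dual_def)
  qed
  ultimately show ?thesis
    using assms chain_dual image_dual unfolding is_A_def is_B_def by (auto simp: image_mono)
qed

lemma is_A_dual:
  assumes "is_B S K b"
  shows "is_A (prod.swap ` S) K (dual K b)"
proof -
  have "snd (dual K b m) \<le> snd x"
    if "m < K" "down (prod.swap ` S) m x" "fst (dual K b (Suc m)) < fst x" for m x
  proof -
    have "up S (K - Suc (K - Suc m)) (prod.swap x)"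
      using that(1,2) down_swap[of S m "prod.swap x"] by (simp add: Suc_diff_Suc)
    moreover have "snd (b (K - Suc m)) < snd (prod.swap x)"
      using that(3) by (simp add: dual_def)
    ultimately have "fst (b (Suc (K - Suc m))) \<le> fst (prod.swap x)"
      using that(1) by (intro is_B_step[OF assms]) auto
    then show ?thesis
      using that(1) by (simp add: dual_def Suc_diff_Suc)
  qed
  moreover have "snd (dual K b K) \<le> snd x" if "down (prod.swap ` S) K x" for x
  proof -
    have "up S K (prod.swap x)"
      using that by (metis down_swap swap_swap)
    then show ?thesis
      using assms by (auto simp: is_B_def dual_def)
  qed
  ultimately show ?thesis
    using assms chain_dual image_dual unfolding is_A_def is_B_def by (auto simp: image_mono)
qed

lemma chain_down: "chain K c \<Longrightarrow> c ` {..K} \<subseteq> S \<Longrightarrow> i \<le> K \<Longrightarrow> down S i (c i)"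
  using down_chain[of K c S 0 0 i] by auto

lemma chain_up: "chain K c \<Longrightarrow> c ` {..K} \<subseteq> S \<Longrightarrow> i \<le> K \<Longrightarrow> up S (K - i) (c i)"
  using up_chain[of K c S 0 i "K - i"] by auto

text \<open>A successor \<open>y\<close> of \<open>a m\<close> with \<open>down S m y\<close> would
  have been a candidate for \<open>a m\<close> of smaller value. Hence \<open>a m\<close> has rank
  exactly \<open>m\<close>.\<close>

lemma is_A_not_down:
  assumes "is_A S K a" "m \<le> K"
  shows "\<not> down S (Suc m) (a m)"
proof
  assume "down S (Suc m) (a m)"
  then obtain y where y: "a m \<rhd> y" "down S m y"
    by (auto simp: down.simps(2))
  show False
  proof (cases "m = K")
    case True
    then show False
      using y is_A_top[OF assms(1), of y] by (auto simp: nw_def)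
  next
    case False
    then have "a (Suc m) \<rhd> a m"
      using assms by (auto simp: is_A_def chain_def)
    then have "snd (a m) \<le> snd y"
      using y False assms is_A_step[OF assms(1), of m y] by (auto simp: nw_def)
    then show False
      using y by (auto simp: nw_def)
  qed
qed

lemma is_B_not_up:
  assumes "is_B S K b" "j \<le> K"
  shows "\<not> up S (Suc (K - j)) (b j)"
proof -
  have "\<not> down (prod.swap ` S) (Suc (K - j)) (dual K b (K - j))"
    by (rule is_A_not_down[OF is_A_dual[OF assms(1)]]) simp
  then show ?thesis
    using assms(2) unfolding dual_def by simp
qed

text \<open>
  A chain \<open>x\<close> that is greedy from the top stays weakly south-west of \<open>y\<close>, a chain \<open>y\<close> that is
  greedy from the bottom stays weakly south-west of \<open>x\<close>.
\<close>

lemma sandwich: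
  fixes x y :: "nat \<Rightarrow> point"
  assumes inj: "\<And>m. lo \<le> m \<Longrightarrow> m \<le> hi \<Longrightarrow>
      fst (x m) \<le> fst (y m) \<longleftrightarrow> snd (x m) \<le> snd (y m)"
    and inj': "\<And>m. lo \<le> m \<Longrightarrow> m \<le> hi \<Longrightarrow>
      fst (y m) \<le> fst (x m) \<longleftrightarrow> snd (y m) \<le> snd (x m)"
    and top: "snd (x hi) \<le> snd (y hi)"
    and down: "\<And>m. lo \<le> m \<Longrightarrow> m < hi \<Longrightarrow> fst (x (Suc m)) \<le> fst (y (Suc m)) \<Longrightarrow> snd (x m) \<le> snd (y m)"
    and bot: "fst (y lo) \<le> fst (x lo)"
    and up: "\<And>m. lo \<le> m \<Longrightarrow> m < hi \<Longrightarrow> snd (y m) \<le> snd (x m) \<Longrightarrow> fst (y (Suc m)) \<le> fst (x (Suc m))"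
    and m: "lo \<le> m" "m \<le> hi"
  shows "x m = y m"
proof -
  \<comment> \<open>Values are compared from \<open>hi\<close> downwards and positions from
    \<open>lo\<close> upwards; \<open>inj\<close> and \<open>inj'\<close> pass from one coordinate
    to the other at each step.\<close>
  have "snd (x m) \<le> snd (y m)"
    using m(2) m(1)
  proof (induction m rule: inc_induct)
    case (step n)
    then show ?case
      using inj[of "Suc n"] down[of n] by auto
  qed (rule top)
  moreover have "fst (y m) \<le> fst (x m)"
    using m(1) m(2)
  proof (induction m rule: dec_induct)
    case (step n)
    then show ?case
      using inj'[of n] up[of n] by auto
  qed (rule bot)
  ultimately show ?thesis
    using inj[of m] inj'[of m] m by (auto intro!: prod_eqI)
qed

lemma antichain_coords:
  assumes "placement S" "x \<in> S" "y \<in> S" "\<not> x \<rhd> y" "\<not> y \<rhd> x"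
  shows "fst x \<le> fst y \<longleftrightarrow> snd x \<le> snd y"
proof (cases "x = y")
  case False
  then have "fst x \<noteq> fst y" "snd x \<noteq> snd y"
    using fst_eqD[OF assms(1-3)] snd_eqD[OF assms(1-3)] by auto
  then show ?thesis
    using assms(4,5) by (auto simp: nw_def)
qed simp

text \<open>If one of two points of equal exact rank preceded the other in a chain, its rank would
  be larger; incomparable points are ordered alike in both coordinates.\<close>

lemma down_level_coords:
  assumes "placement S" "down S m x" "down S m y" "\<not> down S (Suc m) x" "\<not> down S (Suc m) y"
  shows "fst x \<le> fst y \<longleftrightarrow> snd x \<le> snd y"
  using assms down_in down_Suc by (intro antichain_coords[OF assms(1)]) metis+

lemma up_level_coords:
  assumes "placement S" "up S m x" "up S m y" "\<not> up S (Suc m) x" "\<not> up S (Suc m) y"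
  shows "fst x \<le> fst y \<longleftrightarrow> snd x \<le> snd y"
  using assms up_in up_Suc by (intro antichain_coords[OF assms(1)]) metis+

section \<open>Shifting a point set along a chain\<close>

definition shift_points :: "nat \<Rightarrow> (nat \<Rightarrow> point) \<Rightarrow> point set \<Rightarrow> point set" where
  "shift_points K c S = S - c ` {..K}
     \<union> insert (fst (c 0), snd (c K)) {(fst (c (Suc i)), snd (c i)) |i. i < K}"

text \<open>Moving values against fixed positions produces the same points as moving positions
  against fixed values. The shift is therefore self-dual, which transfers results on the A-shift to
  the B-shift.\<close>

lemma swap_shift_points: "prod.swap ` shift_points K c S = shift_points K (dual K c) (prod.swap ` S)"
proof -
  have "prod.swap ` {(fst (c (Suc i)), snd (c i)) |i. i < K} =
      {(fst (dual K c (Suc i)), snd (dual K c i)) |i. i < K}" (is "?L = ?R")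
  proof -
    have "?L = {(snd (c i), fst (c (Suc i))) |i. i < K}"
      by force
    also have "\<dots> = ?R"
    proof -
      have "\<exists>j<K. K - Suc j = i \<and> K - j = Suc i" if "i < K" for i
        using that by (intro exI[of _ "K - Suc i"]) auto
      moreover have "\<exists>i<K. K - Suc j = i \<and> K - j = Suc i" if "j < K" for j
        using that by auto
      ultimately show ?thesis
        unfolding dual_def by (fastforce simp: set_eq_iff)
    qed
    finally show ?thesis .
  qed
  then show ?thesis
    unfolding shift_points_def image_Un image_insert image_dual
    by (simp add: image_set_diff dual_def)
qed

subsection \<open>Effect of the A-shift on chains\<close>

lemma shift_points_cases:
  assumes "z \<in> shift_points K c S"
  obtains (old) "z \<in> S" "z \<notin> c ` {..K}"
  | (wrap) "z = (fst (c 0), snd (c K))"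
  | (step) i where "i < K" "z = (fst (c (Suc i)), snd (c i))"
  using assms unfolding shift_points_def by blast

lemma shift_points_step: "i < K \<Longrightarrow> (fst (c (Suc i)), snd (c i)) \<in> shift_points K c S"
  unfolding shift_points_def by blast

lemma shift_points_old: "z \<in> S \<Longrightarrow> z \<notin> c ` {..K} \<Longrightarrow> z \<in> shift_points K c S"
  unfolding shift_points_def by blast

lemma inj_fst_shift_points:
  assumes S: "placement S" and c: "chain K c" "c ` {..K} \<subseteq> S"
  shows "inj_on fst (shift_points K c S)"
proof -
  have *: "z = z'" if "z \<in> S - c ` {..K}" "fst z = fst (c i)" "i \<le> K" for z z' i
    using that c fst_eqD[OF S, of z "c i"] by auto
  have inj: "i = j" if "fst (c i) = fst (c j)" "i \<le> K" "j \<le> K" for i j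
    using that chain_fst_less[OF c(1)] by (metis less_irrefl linorder_neqE_nat)
  show ?thesis
  proof (rule inj_onI)
    fix z z' assume z: "z \<in> shift_points K c S" "z' \<in> shift_points K c S" "fst z = fst z'"
    show "z = z'"
      using z(1)
    proof (cases rule: shift_points_cases)
      case old
      from z(2) show ?thesis
      proof (cases rule: shift_points_cases)
        case old': old
        then show ?thesis
          using old fst_eqD[OF S] z(3) by blast
      qed (use old z(3) *[of z _ z'] in auto)
    next
      case wrap
      from z(2) show ?thesis
      proof (cases rule: shift_points_cases)
        case old
        then show ?thesis
          using wrap z(3) *[of z' 0 z] by auto
      next
        case (step i)
        then show ?thesis
          using wrap z(3) inj[of 0 "Suc i"] by auto
      qed (use wrap in auto)
    next
      case (step i)
      from z(2) show ?thesis
      proof (cases rule: shift_points_cases)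
        case old
        then show ?thesis
          using step z(3) *[of z' "Suc i" z] by auto
      next
        case wrap
        then show ?thesis
          using step z(3) inj[of "Suc i" 0] by auto
      next
        case step': (step j)
        then show ?thesis
          using step z(3) inj[of "Suc i" "Suc j"] by auto
      qed
    qed
  qed
qed

lemma inj_on_fst_swap: "inj_on fst (prod.swap ` S) \<longleftrightarrow> inj_on snd S"
  unfolding inj_on_def by (simp add: prod_eq_iff)

lemma placement_shift_points:
  assumes S: "placement S" and c: "chain K c" "c ` {..K} \<subseteq> S"
  shows "placement (shift_points K c S)"
proof -
  have "inj_on fst (prod.swap ` shift_points K c S)"
    unfolding swap_shift_points
    using assms by (intro inj_fst_shift_points) (auto simp: chain_dual image_dual image_mono)
  then have "inj_on snd (shift_points K c S)"
    by (simp add: inj_on_fst_swap)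
  moreover have "{(fst (c (Suc i)), snd (c i)) |i. i < K} = (\<lambda>i. (fst (c (Suc i)), snd (c i))) ` {..<K}"
    by auto
  then have "finite (shift_points K c S)"
    using S unfolding shift_points_def placement_def by simp
  ultimately show ?thesis
    using inj_fst_shift_points[OF assms] by (simp add: placement_def)
qed

text \<open>
  Moving a letter of the A-sequence down may give it new predecessors \<open>x\<close> with value between
  \<open>a (t - 1)\<close> and \<open>a t\<close>. The second conjunct replaces a chain ending in such an \<open>x\<close> by one ending
  in \<open>a (t + 1)\<close>, which still precedes \<open>a t\<close>.
\<close>

lemma up_shift_points_aux:
  assumes S: "placement S" and A: "is_A S K a"
  defines "Z \<equiv> shift_points K a S"
  shows "(\<forall>z. up Z m z \<longrightarrow> fst z < fst (a 0) \<longrightarrow>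
            (\<exists>x. fst x = fst z \<and> snd z \<le> snd x \<and> up S m x)) \<and>
         (\<forall>x t. x \<in> S \<longrightarrow> x \<notin> a ` {..K} \<longrightarrow> t \<le> K \<longrightarrow> down S t x \<longrightarrow> snd x < snd (a t) \<longrightarrow>
            up Z m x \<longrightarrow> t < K \<and> fst x < fst (a (Suc t)) \<and> up S m (a (Suc t)))"
proof -
  note ch = is_A_chain[OF A] and memA = is_A_mem[OF A]
  have pos: "\<exists>x\<in>S. fst x = fst z \<and> snd z \<le> snd x \<and>
      (x = z \<and> x \<notin> a ` {..K} \<or> (\<exists>t<K. x = a (Suc t) \<and> snd z = snd (a t)))"
    if "z \<in> Z" "fst z < fst (a 0)" for z
    using that(1) unfolding Z_def
  proof (cases rule: shift_points_cases)
    case (step i)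
    moreover have "snd (a i) < snd (a (Suc i))"
      using step ch by (auto simp: chain_def nw_def)
    ultimately show ?thesis
      by (intro bexI[of _ "a (Suc i)"] memA) auto
  qed (use that(2) in auto)
  \<comment> \<open>Otherwise \<open>x\<close> would have been a smaller choice for
    \<open>a t\<close>.\<close>
  have left: "t < K \<and> fst x < fst (a (Suc t))"
    if "x \<in> S" "x \<notin> a ` {..K}" "t \<le> K" "down S t x" "snd x < snd (a t)" for x t
  proof -
    have "t \<noteq> K"
      using is_A_top[OF A, of x] that by auto
    then have t: "t < K"
      using that by simp
    then have "\<not> fst (a (Suc t)) < fst x"
      using is_A_step[OF A t that(4)] that(5) by auto
    moreover have "fst (a (Suc t)) \<noteq> fst x"
      using fst_eqD[OF S, of "a (Suc t)" x] that t memA by auto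
    ultimately show ?thesis
      using t by simp
  qed
  show ?thesis
  proof (induction m)
    case 0
    then show ?case
      using pos left memA by (fastforce simp: Suc_le_eq)
  next
    case (Suc m)
    note IH1 = Suc[THEN conjunct1, rule_format]
    note IH2 = Suc[THEN conjunct2, rule_format]
    have 1: "\<exists>x. fst x = fst z \<and> snd z \<le> snd x \<and> up S (Suc m) x"
      if z: "up Z (Suc m) z" "fst z < fst (a 0)" for z
    proof -
      obtain z' where z': "z' \<rhd> z" "up Z m z'"
        using z(1) by (auto simp: up.simps(2))
      then obtain x' where x': "fst x' = fst z'" "snd z' \<le> snd x'" "up S m x'"
        using IH1[of z'] z(2) by (auto simp: nw_def)
      obtain x where x: "x \<in> S" "fst x = fst z" "snd z \<le> snd x"
          "x = z \<and> x \<notin> a ` {..K} \<or> (\<exists>t<K. x = a (Suc t) \<and> snd z = snd (a t))"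
        using pos[of z] z up_in by blast
      have "up S (Suc m) x"
      proof (cases "snd x < snd x'")
        case True
        then show ?thesis
          using x x' z' by (intro up_Suc[of _ _ x']) (auto simp: nw_def)
      next
        case False
        \<comment> \<open>Here \<open>x'\<close> is not above \<open>x\<close> although
          \<open>z'\<close> is above \<open>z\<close>, so the value at the position of
          \<open>x\<close> has dropped and \<open>x\<close> is a moved letter.\<close>
        then obtain t where t: "t < K" "x = a (Suc t)" "snd z = snd (a t)"
          using x x' z' by (auto simp: nw_def)
        have x'S: "x' \<in> S"
          using x'(3) up_in by blast
        have lt: "fst x' < fst (a (Suc t))" "snd (a t) < snd x'"
          using x x' z' t by (auto simp: nw_def)
        \<comment> \<open>Letters of A to the left of \<open>a (Suc t)\<close> are above it, and
          \<open>x'\<close> is not. So \<open>x'\<close> is unmoved, and the second claim applies to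
          it.\<close>
        have notA: "x' \<noteq> a s" if "s \<le> K" for s
        proof
          assume "x' = a s"
          then have "Suc t < s"
            using lt t that chain_fst_less[OF ch, of s "Suc t"] by auto
          then show False
            using False t that \<open>x' = a s\<close> chain_snd_less[OF ch, of "Suc t" s] by auto
        qed
        then have x'A: "x' \<notin> a ` {..K}"
          by auto
        have "fst z' < fst (a 0)"
          using z' z(2) by (auto simp: nw_def)
        then obtain y where "y \<in> S" "fst y = fst z'" "y = z' \<or> (\<exists>t<K. y = a (Suc t))"
          using pos[of z'] z'(2) up_in by blast
        then have "x' = z'"
          using x' x'S notA fst_eqD[OF S, of y x'] by (metis Suc_leI)
        moreover have "down S (Suc t) x'"
          using chain_down[OF ch is_A_image[OF A], of t] lt t x'S chain_nw[OF ch, of t "Suc t"]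
          by (intro down_Suc[of _ _ "a t"]) (auto simp: nw_def)
        moreover have "snd x' < snd (a (Suc t))"
          using False t notA[of "Suc t"] snd_eqD[OF S x'S, of "a (Suc t)"] memA[of "Suc t"] by force
        ultimately have "Suc t < K" "up S m (a (Suc (Suc t)))"
          using IH2[of x' "Suc t"] x'S x'A t z'(2) by auto
        then show ?thesis
          using t ch memA[of "Suc t"] by (intro up_Suc[of _ _ "a (Suc (Suc t))"]) (auto simp: chain_def)
      qed
      then show ?thesis
        using x by blast
    qed
    \<comment> \<open>The same case split with \<open>a (Suc t)\<close> in the place of the old
      point; now the link from \<open>z'\<close> to \<open>x\<close> supplies the rank
      \<open>Suc t\<close>.\<close>
    have 2: "up S (Suc m) (a (Suc t))"
      if x: "x \<in> S" "x \<notin> a ` {..K}" "t \<le> K" "down S t x" "snd x < snd (a t)" "up Z (Suc m) x" for x t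
    proof -
      note t = left[OF x(1-5)]
      obtain z' where z': "z' \<rhd> x" "up Z m z'"
        using x(6) by (auto simp: up.simps(2))
      have z'0: "fst z' < fst (a 0)"
        using z' t chain_fst_less[OF ch, of "Suc t" 0] by (auto simp: nw_def)
      then obtain x' where x': "fst x' = fst z'" "snd z' \<le> snd x'" "up S m x'"
        using IH1[of z'] z' by auto
      have x'S: "x' \<in> S"
        using x'(3) up_in by blast
      show ?thesis
      proof (cases "snd (a (Suc t)) < snd x'")
        case True
        then show ?thesis
          using x' z' t memA[of "Suc t"] by (intro up_Suc[of _ _ x']) (auto simp: nw_def)
      next
        case False
        have lt: "fst x' < fst (a (Suc t))"
          using x' z' t by (auto simp: nw_def)
        have notA: "x' \<noteq> a s" if "s \<le> K" for s
        proof
          assume "x' = a s"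
          then have "Suc t < s"
            using lt t that chain_fst_less[OF ch, of s "Suc t"] by auto
          then show False
            using False t that \<open>x' = a s\<close> chain_snd_less[OF ch, of "Suc t" s] by auto
        qed
        then have x'A: "x' \<notin> a ` {..K}"
          by auto
        obtain y where "y \<in> S" "fst y = fst z'" "y = z' \<or> (\<exists>t<K. y = a (Suc t))"
          using pos[of z'] z'0 z'(2) up_in by blast
        then have "x' = z'"
          using x' x'S notA fst_eqD[OF S, of y x'] by (metis Suc_leI)
        moreover have "down S (Suc t) z'"
          using z' x(4) x'S \<open>x' = z'\<close> by (intro down_Suc[of _ _ x]) auto
        moreover have "snd x' < snd (a (Suc t))"
          using False t notA[of "Suc t"] snd_eqD[OF S x'S, of "a (Suc t)"] memA[of "Suc t"] by force
        ultimately have "Suc t < K" "up S m (a (Suc (Suc t)))"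
          using IH2[of x' "Suc t"] x'S x'A t z'(2) by auto
        then show ?thesis
          using t ch memA[of "Suc t"] by (intro up_Suc[of _ _ "a (Suc (Suc t))"]) (auto simp: chain_def)
      qed
    qed
    show ?case
      using 1 2 left by blast
  qed
qed

lemma up_shift_points:
  assumes "placement S" "is_A S K a" "up (shift_points K a S) m z" "fst z < fst (a 0)"
  obtains x where "fst x = fst z" "snd z \<le> snd x" "up S m x"
  using up_shift_points_aux[OF assms(1,2), of m] assms(3,4) by blast

lemma up_shift_points_below:
  assumes "placement S" "is_A S K a" "up (shift_points K a S) m x"
    and "x \<in> S" "x \<notin> a ` {..K}" "t \<le> K" "down S t x" "snd x < snd (a t)"
  shows "t < K" "up S m (a (Suc t))"
  using up_shift_points_aux[OF assms(1,2), of m] assms(3-) by blast+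

lemma dual_dual: "i \<le> K \<Longrightarrow> dual K (dual K c) i = c i"
  by (simp add: dual_def)

subsection \<open>Common letters\<close>

locale AB_chains =
  fixes S :: "point set" and K :: nat and a b :: "nat \<Rightarrow> point"
  assumes S: "placement S" and A: "is_A S K a" and B: "is_B S K b"
begin

lemmas a_chain = is_A_chain[OF A] and a_mem = is_A_mem[OF A]
  and b_chain = is_B_chain[OF B] and b_mem = is_B_mem[OF B]
  and a_image = is_A_image[OF A] and b_image = is_B_image[OF B]

lemma a_down: "i \<le> K \<Longrightarrow> down S i (a i)"
  and a_up: "i \<le> K \<Longrightarrow> up S (K - i) (a i)"
  and b_down: "i \<le> K \<Longrightarrow> down S i (b i)"
  and b_up: "i \<le> K \<Longrightarrow> up S (K - i) (b i)"
  using chain_down[OF a_chain a_image] chain_up[OF a_chain a_image]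
    chain_down[OF b_chain b_image] chain_up[OF b_chain b_image] by auto

lemma a_nw: "i < j \<Longrightarrow> j \<le> K \<Longrightarrow> a j \<rhd> a i"
  by (rule chain_nw[OF a_chain])

lemma b_nw: "i < j \<Longrightarrow> j \<le> K \<Longrightarrow> b j \<rhd> b i"
  by (rule chain_nw[OF b_chain])

lemma swapped: "AB_chains (prod.swap ` S) K (dual K b) (dual K a)"
  using S A B is_A_dual is_B_dual by unfold_locales auto

text \<open>\<open>b j\<close> has rank at least \<open>j\<close>, whereas \<open>a i\<close> has
  rank exactly \<open>i\<close>.\<close>

lemma a_eq_b_le: "a i = b j \<Longrightarrow> i \<le> K \<Longrightarrow> j \<le> K \<Longrightarrow> j \<le> i"
  using b_down[of j] is_A_not_down[OF A, of i] down_mono[of S j "b j" "Suc i"]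
  by (metis not_less_eq_eq)

lemma fst_b0_le: "fst (b 0) \<le> fst (a 0)"
  using is_B_bot[OF B, of "a 0"] a_up[of 0] by simp

text \<open>
  Below the common point the chains have equal \<open>down\<close> levels, above it equal \<open>up\<close> levels.
\<close>

lemma eq_if_common:
  assumes "i \<le> K" "a i = b i" and m: "m \<le> K"
  shows "a m = b m"
proof (rule sandwich[of 0 K])
  have coords: "(fst (a m) \<le> fst (b m) \<longleftrightarrow> snd (a m) \<le> snd (b m)) \<and>
      (fst (b m) \<le> fst (a m) \<longleftrightarrow> snd (b m) \<le> snd (a m))" if "m \<le> K" for m
  proof (cases "m \<le> i")
    case True
    have "\<not> down S (Suc m) (b m)"
    proof
      assume "down S (Suc m) (b m)"
      then have "down S (Suc m + (i - m)) (b (m + (i - m)))"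
        by (rule down_chain[OF b_chain b_image]) (use True assms in auto)
      then show False
        using True assms is_A_not_down[OF A, of i] by simp
    qed
    moreover have "\<not> down S (Suc m) (a m)"
      using is_A_not_down[OF A that] .
    moreover have "down S m (a m)" "down S m (b m)"
      using that a_down b_down by auto
    ultimately show ?thesis
      using down_level_coords[OF S] by blast
  next
    case False
    have "\<not> up S (Suc (K - m)) (a m)"
    proof
      assume "up S (Suc (K - m)) (a m)"
      then have "up S (Suc (K - m)) (a (i + (m - i)))"
        using False by simp
      then have "up S (Suc (K - m) + (m - i)) (a i)"
        by (rule up_chain[OF a_chain a_image]) (use False that in auto)
      then show False
        using False that assms is_B_not_up[OF B, of i] by (simp add: Suc_diff_le)
    qed
    moreover have "\<not> up S (Suc (K - m)) (b m)"
      using is_B_not_up[OF B that] .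
    moreover have "up S (K - m) (a m)" "up S (K - m) (b m)"
      using that a_up b_up by auto
    ultimately show ?thesis
      using up_level_coords[OF S] by blast
  qed
  show "fst (a m) \<le> fst (b m) \<longleftrightarrow> snd (a m) \<le> snd (b m)"
       "fst (b m) \<le> fst (a m) \<longleftrightarrow> snd (b m) \<le> snd (a m)" if "m \<le> K" for m
    using coords[OF that] by auto
  show "snd (a K) \<le> snd (b K)"
    by (rule is_A_top[OF A b_down[OF order_refl]])
  show "snd (a m) \<le> snd (b m)" if "m < K" "fst (a (Suc m)) \<le> fst (b (Suc m))" for m
    using that b_nw[of m "Suc m"] b_down[of m]
    by (intro is_A_step[OF A]) (auto simp: nw_def)
  show "fst (b 0) \<le> fst (a 0)"
    by (rule fst_b0_le)
  show "fst (b (Suc m)) \<le> fst (a (Suc m))" if "m < K" "snd (b m) \<le> snd (a m)" for m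
    using that a_nw[of m "Suc m"] a_up[of "Suc m"]
    by (intro is_B_step[OF B]) (auto simp: nw_def)
qed (use m in auto)

text \<open>Between two common points A runs through \<open>f\<close> links and B through
  \<open>e\<close>. If B had more, the upper point would exceed its rank as a letter of A; if A had
  more, the lower point would exceed its \<open>up\<close> rank as a letter of B. With equal lengths
  the two segments have equal ranks and \<open>sandwich\<close> applies.\<close>

lemma common_interval:
  assumes "a (j + d) = b j" "a (j' + d') = b j'" "j < j'" "j' + d' \<le> K" "j + d \<le> K"
  shows "d' = d \<and> (\<forall>m. j \<le> m \<longrightarrow> m \<le> j' \<longrightarrow> a (m + d) = b m)"
proof
  have "j + d < j' + d'"
    using assms b_nw[of j j'] chain_fst_less[OF a_chain, of "j' + d'" "j + d"]
    by (auto simp: nw_def)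
  then obtain f where f: "j' + d' = j + d + f"
    by (metis le_Suc_ex less_imp_le)
  obtain e where e: "j' = j + e"
    using assms(3) by (metis le_Suc_ex less_imp_le)
  have "b (j + e) = a (j + d + f)"
    using assms(2) by (metis e f)
  have "j + e \<le> K" "j + d + f \<le> K"
    using assms(4) e f by auto
  have "\<not> f < e"
  proof
    assume *: "f < e"
    have "down S (j + d + e) (b (j + e))"
      by (rule down_chain[OF b_chain b_image]) (use \<open>j + e \<le> K\<close> a_down[OF assms(5)] assms(1) in auto)
    moreover have "Suc (j + d + f) \<le> j + d + e"
      using * by simp
    ultimately have "down S (Suc (j + d + f)) (b (j + e))"
      by (rule down_mono)
    then show False
      using is_A_not_down[OF A \<open>j + d + f \<le> K\<close>] \<open>b (j + e) = a (j + d + f)\<close> by simp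
  qed
  moreover have "\<not> e < f"
  proof
    assume *: "e < f"
    have "up S (K - (j + e) + f) (a (j + d))"
      by (rule up_chain[OF a_chain a_image])
        (use \<open>j + d + f \<le> K\<close> b_up[OF \<open>j + e \<le> K\<close>] \<open>b (j + e) = a (j + d + f)\<close> in auto)
    moreover have "Suc (K - j) \<le> K - (j + e) + f"
      using * \<open>j + e \<le> K\<close> by simp
    ultimately have "up S (Suc (K - j)) (a (j + d))"
      by (rule up_mono)
    then show False
      using is_B_not_up[OF B, of j] assms(1,5) by simp
  qed
  ultimately show d: "d' = d"
    using e f by simp
  have down_b: "down S (m + d) (b m)" if "j \<le> m" "m \<le> j'" for m
  proof -
    have "j + (m - j) = m" "j + d + (m - j) = m + d"
      using that by auto
    then show ?thesis
      using down_chain[OF b_chain b_image, of "j + d" j "m - j"]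
        a_down[of "j + d"] that assms by (simp add: add.commute[of m d])
  qed
  have up_a: "up S (K - m) (a (m + d))" if "j \<le> m" "m \<le> j'" for m
  proof -
    have "m + d + (j' - m) = j' + d" "K - j' + (j' - m) = K - m"
      using that assms by auto
    then show ?thesis
      using up_chain[OF a_chain a_image, of "K - j'" "m + d" "j' - m"]
        b_up[of j'] assms d by (simp add: add.commute[of d j'])
  qed
  show "\<forall>m. j \<le> m \<longrightarrow> m \<le> j' \<longrightarrow> a (m + d) = b m"
  proof (intro allI impI)
    fix m assume m: "j \<le> m" "m \<le> j'"
    have coords: "(fst (a (m + d)) \<le> fst (b m) \<longleftrightarrow> snd (a (m + d)) \<le> snd (b m)) \<and>
        (fst (b m) \<le> fst (a (m + d)) \<longleftrightarrow> snd (b m) \<le> snd (a (m + d)))" if m: "j \<le> m" "m \<le> j'" for m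
    proof -
      have "\<not> down S (Suc (m + d)) (b m)"
      proof
        assume "down S (Suc (m + d)) (b m)"
        then have "down S (Suc (m + d) + (j' - m)) (b (m + (j' - m)))"
          by (rule down_chain[OF b_chain b_image]) (use m assms in auto)
        then show False
          using m assms d is_A_not_down[OF A, of "j' + d'"] by (simp add: add.commute[of d j'])
      qed
      moreover have "\<not> down S (Suc (m + d)) (a (m + d))"
        using m assms d by (intro is_A_not_down[OF A]) auto
      moreover have "down S (m + d) (a (m + d))"
        using m assms d by (intro a_down) auto
      ultimately show ?thesis
        using down_level_coords[OF S] down_b[OF m] by blast
    qed
    show "a (m + d) = b m"
    proof (rule sandwich[of j j' "\<lambda>m. a (m + d)" b])
      show "snd (a (m + d)) \<le> snd (b m)"
        if "j \<le> m" "m < j'" "fst (a (Suc m + d)) \<le> fst (b (Suc m))" for m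
        using that assms d b_nw[of m "Suc m"] down_b[of m]
        by (intro is_A_step[OF A]) (auto simp: nw_def)
      show "fst (b (Suc m)) \<le> fst (a (Suc m + d))"
        if "j \<le> m" "m < j'" "snd (b m) \<le> snd (a (m + d))" for m
        using that assms d a_nw[of "m + d" "Suc m + d"] up_a[of "Suc m"]
        by (intro is_B_step[OF B]) (auto simp: nw_def)
    qed (use m assms d coords in auto)
  qed
qed

text \<open>If B went further left than A just above a common point, it would stay to the left and
  below all the way up, because the greedy choices of A leave no room to return. At index
  \<open>K\<close> of A it would then provide a smaller first letter.\<close>

lemma fst_a_le_above:
  assumes "a (q + d) = b q" "q + d < K"
  shows "fst (a (Suc (q + d))) \<le> fst (b (Suc q))"
proof (rule ccontr)
  assume "\<not> ?thesis"
  then have less: "fst (b (Suc q)) < fst (a (Suc (q + d)))"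
    by simp
  have down_b: "down S (q + d + i) (b (q + i))" if "q + i \<le> K" for i
      by (rule down_chain[OF b_chain b_image]) (use assms a_down[of "q + d"] that in auto)
  \<comment> \<open>Otherwise \<open>b (q + i)\<close> precedes \<open>a (q + d + i)\<close> in a
    chain, and continuing along A down to \<open>b q\<close> exceeds the \<open>up\<close> rank of
    \<open>b q\<close>.\<close>
  have b_below: "snd (b (q + i)) < snd (a (q + d + i))"
    if i: "0 < i" "q + d + i \<le> K" "fst (b (q + i)) < fst (a (q + d + i))" for i
  proof (rule ccontr)
    assume "\<not> ?thesis"
    moreover have "snd (b (q + i)) \<noteq> snd (a (q + d + i))"
      using i snd_eqD[OF S b_mem a_mem] by (metis add.commute add.left_commute le_add2 le_trans less_irrefl)
    ultimately have "b (q + i) \<rhd> a (q + d + i)"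
      using i by (auto simp: nw_def)
    moreover have "up S (K - (q + i)) (b (q + i))"
      using i by (intro chain_up b_chain b_image) auto
    ultimately have "up S (Suc (K - (q + i))) (a (q + d + i))"
      using i a_mem by (intro up_Suc[of _ _ "b (q + i)"]) auto
    then have "up S (Suc (K - (q + i)) + i) (a (q + d))"
      by (rule up_chain[OF a_chain a_image]) (use i in auto)
    moreover have "Suc (K - (q + i)) + i = Suc (K - q)"
      using i by simp
    ultimately show False
      using is_B_not_up[OF B, of q] assms i by simp
  qed
  have pos: "fst (b (q + Suc i)) < fst (a (q + d + Suc i))" if "q + d + Suc i \<le> K" for i
    using that
  proof (induction i)
    case 0
    then show ?case
      using less by simp
  next
    case (Suc i)
    then have "snd (b (q + Suc i)) < snd (a (q + d + Suc i))"
      by (intro b_below) auto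
    then have "\<not> fst (a (q + d + Suc (Suc i))) < fst (b (q + Suc i))"
      using is_A_step[OF A, of "q + d + Suc i" "b (q + Suc i)"] down_b[of "Suc i"] Suc.prems by auto
    moreover have "fst (b (q + Suc (Suc i))) < fst (b (q + Suc i))"
      using Suc.prems b_nw[of "q + Suc i" "q + Suc (Suc i)"] by (auto simp: nw_def)
    ultimately show ?case
      by simp
  qed
  define i where "i = K - Suc (q + d)"
  have i: "q + d + Suc i = K"
    using assms(2) by (simp add: i_def)
  then have "snd (b (q + Suc i)) < snd (a K)"
    using pos[of i] b_below[of "Suc i"] by simp
  moreover have "down S K (b (q + Suc i))"
    using down_b[of "Suc i"] i by simp
  ultimately show False
    using is_A_top[OF A] by fastforce
qed

lemma snd_b_le_below:
  assumes "a (Suc p + d) = b (Suc p)" "Suc p + d \<le> K"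
  shows "snd (b p) \<le> snd (a (p + d))"
proof -
  interpret D: AB_chains "prod.swap ` S" K "dual K b" "dual K a"
    by (rule swapped)
  have "fst (dual K b (Suc (K - Suc (p + d) + d))) \<le> fst (dual K a (Suc (K - Suc (p + d))))"
    using assms by (intro D.fst_a_le_above) (auto simp: dual_def)
  moreover have "K - Suc (K - Suc (p + d) + d) = p" "K - Suc (K - Suc (p + d)) = p + d"
    using assms by auto
  ultimately show ?thesis
    by (simp add: dual_def)
qed

text \<open>\<open>p\<close> and \<open>q\<close> are the extreme B-indices of common letters. The
  offset is positive by \<open>a_eq_b_le\<close> and the first hypothesis, and
  \<open>common_interval\<close> makes it constant and fills the gap.\<close>

lemma common_structure:
  assumes "\<forall>i\<le>K. a i \<noteq> b i" "\<exists>i\<le>K. \<exists>j\<le>K. a i = b j"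
  obtains p q d where "0 < d" "p \<le> q" "q + d \<le> K"
    "\<And>r. p \<le> r \<Longrightarrow> r \<le> q \<Longrightarrow> a (r + d) = b r"
    "\<And>i j. i \<le> K \<Longrightarrow> j \<le> K \<Longrightarrow> a i = b j \<Longrightarrow> i = j + d \<and> p \<le> j \<and> j \<le> q"
proof -
  define J where "J = {j. j \<le> K \<and> (\<exists>i\<le>K. a i = b j)}"
  have J: "finite J" "J \<noteq> {}"
    using assms(2) by (auto simp: J_def)
  define p q where "p = Min J" and "q = Max J"
  have "p \<in> J" "q \<in> J" "p \<le> q"
    unfolding p_def q_def using J by auto
  then obtain i where i: "i \<le> K" "a i = b p"
    by (auto simp: J_def)
  define d where "d = i - p"
  have "p < i"
    using i a_eq_b_le[of i p] assms(1) \<open>p \<in> J\<close> by (auto simp: J_def order_less_le)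
  then have d: "0 < d" "a (p + d) = b p" "p + d \<le> K"
    using i by (auto simp: d_def)
  have shift: "i = j + d \<and> p \<le> j \<and> j \<le> q" if ij: "i \<le> K" "j \<le> K" "a i = b j" for i j
  proof -
    have "j \<in> J"
      using ij by (auto simp: J_def)
    then have pj: "p \<le> j" "j \<le> q"
      unfolding p_def q_def using J by auto
    have "j \<le> i"
      using a_eq_b_le ij by blast
    show ?thesis
    proof (cases "p = j")
      case True
      then show ?thesis
        using chain_eq[OF a_chain, of i "p + d"] ij d pj by auto
    next
      case False
      then show ?thesis
        using common_interval[of p d j "i - j"] d ij pj \<open>j \<le> i\<close> by auto
    qed
  qed
  obtain i' where i': "i' \<le> K" "q \<le> K" "a i' = b q"
    using \<open>q \<in> J\<close> by (auto simp: J_def)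
  then have q: "q + d \<le> K" "a (q + d) = b q"
    using shift[of i' q] by auto
  have "a (r + d) = b r" if "p \<le> r" "r \<le> q" for r
  proof (cases "p = q")
    case True
    then show ?thesis
      using that d by auto
  next
    case False
    then show ?thesis
      using common_interval[of p d q d] d q \<open>p \<le> q\<close> that by auto
  qed
  then show thesis
    using that[of d p q] d(1) \<open>p \<le> q\<close> q(1) shift by blast
qed

end

subsection \<open>Overlapping sequences\<close>

text \<open>Writing the offset as \<open>Suc e\<close> makes it positive and makes
  \<open>a (j + e)\<close> the letter that the A-shift moves to the position of
  \<open>b j\<close>.\<close>

locale overlapping = AB_chains +
  fixes p q e :: nat
  assumes pq: "p \<le> q" and q: "q + Suc e \<le> K"
    and common: "\<And>r. p \<le> r \<Longrightarrow> r \<le> q \<Longrightarrow> a (r + Suc e) = b r"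
    and only: "\<And>i j. i \<le> K \<Longrightarrow> j \<le> K \<Longrightarrow> a i = b j \<Longrightarrow> i = j + Suc e \<and> p \<le> j \<and> j \<le> q"
begin

abbreviation "Z \<equiv> shift_points K a S"
abbreviation "Y \<equiv> shift_points K b S"

lemma placement_Z: "placement Z"
  by (rule placement_shift_points[OF S a_chain a_image])

lemma placement_Y: "placement Y"
  by (rule placement_shift_points[OF S b_chain b_image])

lemma b_not_a: "j \<le> K \<Longrightarrow> j < p \<or> q < j \<Longrightarrow> b j \<notin> a ` {..K}"
  using only by (metis atMost_iff imageE not_le)

text \<open>Places all of B where \<open>up_shift_points\<close> is available.\<close>

lemma fst_b_less: "j \<le> K \<Longrightarrow> fst (b j) < fst (a 0)"
proof -
  assume j: "j \<le> K"
  have "a 0 \<noteq> b 0"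
    using only[of 0 0] by auto
  then have "fst (b 0) \<noteq> fst (a 0)"
    using fst_eqD[OF S b_mem a_mem, of 0 0] by auto
  moreover have "fst (b j) \<le> fst (b 0)"
    using chain_fst_less[OF b_chain, of 0 j] j by auto
  ultimately show ?thesis
    using fst_b0_le by simp
qed

text \<open>The chain left over from the B-sequence after the A-shift, with the same positions.\<close>

definition w :: "nat \<Rightarrow> point" where
  "w j = (if p \<le> j \<and> j \<le> q then (fst (b j), snd (a (j + e))) else b j)"

lemma fst_w [simp]: "fst (w j) = fst (b j)"
  by (simp add: w_def)

text \<open>Keeps \<open>w\<close> decreasing at the lower end of the block, where the lowered
  letter meets an unmoved one.\<close>

lemma snd_b_less_below:
  assumes "Suc j = p"
  shows "snd (b j) < snd (a (p + e))"
proof -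
  have "snd (b j) \<le> snd (a (j + Suc e))"
    using assms pq q common[of p] by (intro snd_b_le_below) auto
  moreover have "a (j + Suc e) \<noteq> b j"
    using only[of "j + Suc e" j] assms pq q by auto
  then have "snd (b j) \<noteq> snd (a (j + Suc e))"
    using snd_eqD[OF S b_mem a_mem, of j "j + Suc e"] assms pq q by auto
  ultimately show ?thesis
    using assms by auto
qed

lemma w_chain: "chain K w"
  unfolding chain_def
proof (intro allI impI)
  fix j assume j: "j < K"
  have b: "b (Suc j) \<rhd> b j"
    using j b_nw by auto
  consider "Suc j = p" | "p \<le> j" "j < q" | "j = q" | "Suc j < p \<or> q < j"
    using pq by linarith
  then have "snd (w j) < snd (w (Suc j))"
  proof cases
    case 1
    then show ?thesis
      using snd_b_less_below pq by (auto simp: w_def)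
  next
    case 2
    then show ?thesis
      using q chain_snd_less[OF a_chain, of "j + e" "Suc j + e"] by (auto simp: w_def)
  next
    case 3
    then have "snd (a (q + e)) < snd (b q)"
      using q pq chain_snd_less[OF a_chain, of "q + e" "q + Suc e"] common[of q] by auto
    then show ?thesis
      using 3 pq b by (auto simp: w_def nw_def)
  next
    case 4
    then show ?thesis
      using b pq by (auto simp: w_def nw_def)
  qed
  then show "w (Suc j) \<rhd> w j"
    using b by (simp add: nw_def)
qed

lemma w_image: "w ` {..K} \<subseteq> Z"
proof
  fix z assume "z \<in> w ` {..K}"
  then obtain j where j: "j \<le> K" "z = w j"
    by auto
  show "z \<in> Z"
  proof (cases "p \<le> j \<and> j \<le> q")
    case True
    then have "z = (fst (a (Suc (j + e))), snd (a (j + e)))"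
      using j common[of j] by (simp add: w_def)
    then show ?thesis
      using shift_points_step[of "j + e" K a S] True q by auto
  next
    case False
    then show ?thesis
      using j b_mem b_not_a[of j] by (auto simp: w_def intro!: shift_points_old)
  qed
qed

lemma w_up: "j \<le> K \<Longrightarrow> up Z (K - j) (w j)"
  by (rule chain_up[OF w_chain w_image])

end

section \<open>The B-sequence after the A-shift\<close>

locale overlapping_B = overlapping +
  fixes b'
  assumes B': "is_B (shift_points K a S) K b'"
begin

lemmas b'_chain = is_B_chain[OF B'] and b'_mem = is_B_mem[OF B'] and b'_image = is_B_image[OF B']

lemma b'_up: "j \<le> K \<Longrightarrow> up Z (K - j) (b' j)"
  by (rule chain_up[OF b'_chain b'_image])

lemma b'_nw: "i < j \<Longrightarrow> j \<le> K \<Longrightarrow> b' j \<rhd> b' i"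
  by (rule chain_nw[OF b'_chain])

lemma b'_old_point:
  assumes "j \<le> K" "fst (b' j) \<le> fst (b j)"
  obtains x where "fst x = fst (b' j)" "snd (b' j) \<le> snd x" "up S (K - j) x"
proof -
  have "fst (b' j) < fst (a 0)"
    using assms fst_b_less[of j] by simp
  then show thesis
    using up_shift_points[OF S A b'_up[OF assms(1)]] that by blast
qed

lemma b'_eq_wI:
  assumes "j \<le> K" "fst (b' j) \<le> fst (b j)" "fst (b j) \<le> fst (b' j)"
  shows "b' j = w j"
  using assms w_image b'_mem by (intro fst_eqD[OF placement_Z]) auto

lemma fst_b'_Suc_le: "j < K \<Longrightarrow> snd (b' j) < snd (w (Suc j)) \<Longrightarrow> fst (b' (Suc j)) \<le> fst (b (Suc j))"
  using is_B_step[OF B' _ w_up, of j] by simp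

text \<open>As a candidate, \<open>w (Suc j)\<close> bounds the position from the right. The old
  point at the position of \<open>b' (Suc j)\<close> was a candidate for \<open>b (Suc j)\<close>,
  which bounds it from the left.\<close>

lemma b'_Suc_eq_wI:
  assumes j: "j < K" "snd (b' j) < snd (w (Suc j))" "snd (b j) \<le> snd (b' j)"
  shows "b' (Suc j) = w (Suc j)"
proof -
  have le: "fst (b' (Suc j)) \<le> fst (b (Suc j))"
    using j by (intro fst_b'_Suc_le)
  obtain x where x: "fst x = fst (b' (Suc j))" "snd (b' (Suc j)) \<le> snd x" "up S (K - Suc j) x"
    by (rule b'_old_point[OF Suc_leI[OF j(1)] le])
  have "snd (b j) < snd x"
    using x(2) j b'_nw[of j "Suc j"] by (auto simp: nw_def)
  then have "fst (b (Suc j)) \<le> fst (b' (Suc j))"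
    using is_B_step[OF B j(1) x(3)] x(1) by simp
  then show ?thesis
    using j(1) le by (intro b'_eq_wI) auto
qed

lemma b'_low: "j \<le> p \<Longrightarrow> b' j = w j"
proof (induction j)
  case 0
  have le: "fst (b' 0) \<le> fst (b 0)"
    using is_B_bot[OF B' w_up[of 0, simplified]] by simp
  obtain x where "fst x = fst (b' 0)" "up S K x"
    by (rule b'_old_point[OF _ le]) auto
  then have "fst (b 0) \<le> fst (b' 0)"
    using is_B_bot[OF B, of x] by simp
  then show ?case
    using le by (intro b'_eq_wI) auto
next
  case (Suc j)
  then have "b' j = b j" "w j = b j"
    by (auto simp: w_def)
  moreover have "j < K"
    using Suc.prems pq q by simp
  ultimately show ?case
    using w_chain by (intro b'_Suc_eq_wI) (auto simp: chain_def nw_def)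
qed

text \<open>If \<open>b' (Suc j)\<close> is strictly left of \<open>b (Suc j)\<close>, its old point
  is at or below \<open>b j\<close>. No letter of A or B lies there, so the point is unmoved. The
  rank is carried along for use at the upper end of the block.\<close>

lemma b'_middle_aux:
  assumes "p \<le> j" "j \<le> q"
  shows "snd (b' j) \<le> snd (a (j + e)) \<and> (b' j = w j \<or>
    b' j \<in> S \<and> b' j \<notin> a ` {..K} \<and> b' j \<notin> b ` {..K} \<and> down S (j + e) (b' j))"
  using assms
proof (induction j rule: dec_induct)
  case base
  then show ?case
    using b'_low[of p] pq by (simp add: w_def)
next
  case (step j)
  have jK: "Suc j \<le> K" "Suc j + e < K"
    using step.prems q by auto
  have wj: "w (Suc j) = (fst (b (Suc j)), snd (b j))" "snd (w (Suc j)) = snd (a (Suc j + e))"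
    using step common[of j] by (auto simp: w_def)
  have IH: "snd (b' j) \<le> snd (a (j + e))" "b' j = w j \<or> down S (j + e) (b' j)"
    using step by auto
  have "snd (b' j) < snd (w (Suc j))"
    using IH(1) wj jK chain_snd_less[OF a_chain, of "j + e" "Suc j + e"] by simp
  then have le: "fst (b' (Suc j)) \<le> fst (b (Suc j))"
    using jK by (intro fst_b'_Suc_le) auto
  show ?case
  proof (cases "fst (b' (Suc j)) = fst (b (Suc j))")
    case True
    then show ?thesis
      using b'_eq_wI[OF jK(1)] wj by simp
  next
    case False
    then have less: "fst (b' (Suc j)) < fst (b (Suc j))"
      using le by simp
    obtain x where x: "fst x = fst (b' (Suc j))" "snd (b' (Suc j)) \<le> snd x" "up S (K - Suc j) x"
      by (rule b'_old_point[OF jK(1) le])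
    have xS: "x \<in> S"
      using x(3) up_in by blast
    have xb: "snd x \<le> snd (b j)"
      using is_B_step[OF B _ x(3)] less x(1) jK by force
    have notA: "x \<noteq> a i" if "i \<le> K" for i
    proof
      assume "x = a i"
      then have "fst (a i) < fst (a (Suc j + Suc e))"
        using less x(1) common[of "Suc j"] step by simp
      then have "Suc j + Suc e < i"
        using chain_fst_less[OF a_chain, of i "Suc j + Suc e"] that jK by simp
      moreover have "snd (a i) \<le> snd (a (j + Suc e))"
        using xb \<open>x = a i\<close> common[of j] step by simp
      ultimately show False
        using chain_snd_less[OF a_chain, of "j + Suc e" i] that by simp
    qed
    have notB: "x \<noteq> b i" if "i \<le> K" for i
    proof
      assume "x = b i"
      then have "Suc j < i"
        using less x(1) chain_fst_less[OF b_chain, of i "Suc j"] that jK by simp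
      then show False
        using xb \<open>x = b i\<close> chain_snd_less[OF b_chain, of j i] that by simp
    qed
    have "x \<in> Z"
      using xS notA by (intro shift_points_old) auto
    then have eq: "b' (Suc j) = x"
      using fst_eqD[OF placement_Z b'_mem[OF jK(1)]] x(1) by simp
    have xb': "x \<rhd> b' j"
      using b'_nw[of j "Suc j"] jK eq by simp
    have "down S (Suc j + e) x"
    proof (cases "b' j = w j")
      case True
      \<comment> \<open>\<open>w j\<close> has the value of \<open>a (j + e)\<close> but is further
        left, so \<open>x\<close> also precedes the old point \<open>a (j + e)\<close>, whose rank
        is known.\<close>
      have "fst (b j) < fst (a (j + e))"
        using a_nw[of "j + e" "j + Suc e"] common[of j] step jK by (simp add: nw_def)
      then have "x \<rhd> a (j + e)"
        using xb' True step by (simp add: w_def nw_def)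
      then show ?thesis
        using down_Suc[OF xS _ a_down[of "j + e"]] jK by simp
    next
      case False
      then show ?thesis
        using down_Suc[OF xS xb'] IH(2) by simp
    qed
    then show ?thesis
      using xS notA notB eq xb common[of j] step by auto
  qed
qed

lemma b'_p: "b' p = (fst (b p), snd (a (p + e)))"
  using b'_low[of p] pq by (simp add: w_def)

lemma b'_below: "j < p \<Longrightarrow> b' j = b j"
  using b'_low[of j] by (simp add: w_def)

lemma b'_middle:
  assumes "p < j" "j \<le> q"
  shows "b' j = (fst (b j), snd (a (j + e))) \<or> b' j \<in> S \<and> b' j \<notin> a ` {..K} \<and> b' j \<notin> b ` {..K}"
  using b'_middle_aux[of j] assms by (auto simp: w_def)

lemma snd_b'_q_less: "snd (b' q) < snd (b q)"
  using b'_middle_aux[of q] pq q chain_snd_less[OF a_chain, of "q + e" "q + Suc e"] common[of q] by simp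

text \<open>A rival \<open>x\<close> further left is unmoved, lies below
  \<open>b q = a (q + Suc e)\<close> and has rank at least \<open>q + Suc e\<close>.
  \<open>up_shift_points_below\<close> turns it into the next letter of A as a candidate for
  \<open>b (Suc q)\<close>. Together with \<open>fst_a_le_above\<close> this letter is
  \<open>b (Suc q)\<close> itself, contrary to the choice of \<open>q\<close>.\<close>

lemma b'_Suc_q: "b' (Suc q) = b (Suc q)"
proof -
  have qK: "q < K"
    using q by simp
  have w: "w (Suc q) = b (Suc q)"
    by (simp add: w_def)
  have lt: "snd (b' q) < snd (w (Suc q))"
    using snd_b'_q_less w b_nw[of q "Suc q"] qK by (simp add: nw_def)
  then have le: "fst (b' (Suc q)) \<le> fst (b (Suc q))"
    using qK by (intro fst_b'_Suc_le)
  have "\<not> fst (b' (Suc q)) < fst (b (Suc q))"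
  proof
    assume less: "fst (b' (Suc q)) < fst (b (Suc q))"
    obtain x where x: "fst x = fst (b' (Suc q))" "snd (b' (Suc q)) \<le> snd x" "up S (K - Suc q) x"
      by (rule b'_old_point[OF Suc_leI[OF qK] le])
    have xS: "x \<in> S"
      using x(3) up_in by blast
    have xb: "snd x \<le> snd (b q)"
      using is_B_step[OF B qK x(3)] less x(1) by force
    have aq: "a (q + Suc e) = b q"
      using common pq by simp
    have notA: "x \<noteq> a i" if "i \<le> K" for i
    proof
      assume x_eq: "x = a i"
      then have "i \<le> q + Suc e"
        using xb aq chain_snd_less[OF a_chain, of "q + Suc e" i] that q by fastforce
      then have "fst (b q) \<le> fst x"
        using x_eq aq chain_fst_less[OF a_chain, of i "q + Suc e"] that q by fastforce
      then show False
        using less x(1) b_nw[of q "Suc q"] qK by (simp add: nw_def)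
    qed
    then have xA: "x \<notin> a ` {..K}"
      by auto
    have "x \<in> Z"
      using xS xA by (rule shift_points_old)
    then have eq: "b' (Suc q) = x"
      using fst_eqD[OF placement_Z b'_mem] x(1) qK by simp
    have xb': "x \<rhd> b' q"
      using b'_nw[of q "Suc q"] qK eq by simp
    have "down S (q + Suc e) x"
    proof (cases "b' q = w q")
      case True
      have "fst (b q) < fst (a (q + e))"
        using a_nw[of "q + e" "q + Suc e"] aq q by (simp add: nw_def)
      then have "x \<rhd> a (q + e)"
        using xb' True pq by (simp add: w_def nw_def)
      then show ?thesis
        using down_Suc[OF xS _ a_down[of "q + e"]] q by simp
    next
      case False
      then show ?thesis
        using down_Suc[OF xS xb'] b'_middle_aux[of q] pq by simp
    qed
    moreover have "snd x < snd (a (q + Suc e))"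
      using xb aq notA[of "q + Suc e"] q snd_eqD[OF S xS a_mem, of "q + Suc e"] by fastforce
    moreover have "up Z (K - Suc q) x"
      using b'_up[of "Suc q"] qK eq by simp
    ultimately have *: "q + Suc e < K" "up S (K - Suc q) (a (Suc (q + Suc e)))"
      using up_shift_points_below[OF S A _ xS xA, of "K - Suc q" "q + Suc e"] q by auto
    then have "snd (b q) < snd (a (Suc (q + Suc e)))"
      using aq a_nw[of "q + Suc e" "Suc (q + Suc e)"] by (simp add: nw_def)
    then have "fst (b (Suc q)) \<le> fst (a (Suc (q + Suc e)))"
      using is_B_step[OF B qK *(2)] by simp
    moreover have "fst (a (Suc (q + Suc e))) \<le> fst (b (Suc q))"
      using fst_a_le_above[OF aq *(1)] .
    ultimately have "a (Suc (q + Suc e)) = b (Suc q)"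
      using fst_eqD[OF S a_mem b_mem, of "Suc (q + Suc e)" "Suc q"] *(1) qK by simp
    then show False
      using only[of "Suc (q + Suc e)" "Suc q"] *(1) qK by simp
  qed
  then show ?thesis
    using b'_eq_wI[OF Suc_leI[OF qK]] le w by simp
qed

lemma b'_above:
  assumes "q < j" "j \<le> K"
  shows "b' j = b j"
proof -
  have "Suc q \<le> j"
    using assms by simp
  then show ?thesis
    using assms(2)
  proof (induction j rule: dec_induct)
    case base
    show ?case
      by (rule b'_Suc_q)
  next
    case (step j)
    then have "w (Suc j) = b (Suc j)" "b' j = b j"
      by (auto simp: w_def)
    then show ?case
      using b'_Suc_eq_wI[of j] step.prems b_nw[of j "Suc j"] by (simp add: nw_def)
  qed
qed

end

context overlapping
begin

text \<open>Reflecting both indices preserves the offset. The block is now counted by its old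
  A-indices, since the reversed A plays the role of B.\<close>

lemma swapped_overlapping:
  "overlapping (prod.swap ` S) K (dual K b) (dual K a) (K - (q + Suc e)) (K - (p + Suc e)) e"
proof -
  interpret D: AB_chains "prod.swap ` S" K "dual K b" "dual K a"
    by (rule swapped)
  show ?thesis
  proof unfold_locales
    show "K - (q + Suc e) \<le> K - (p + Suc e)" "K - (p + Suc e) + Suc e \<le> K"
      using pq q by auto
    show "dual K b (r + Suc e) = dual K a r" if "K - (q + Suc e) \<le> r" "r \<le> K - (p + Suc e)" for r
    proof -
      have "K - (r + Suc e) + Suc e = K - r" "p \<le> K - (r + Suc e)" "K - (r + Suc e) \<le> q"
        using that pq q by auto
      then have "a (K - r) = b (K - (r + Suc e))"
        using common[of "K - (r + Suc e)"] by metis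
      then show ?thesis
        by (simp add: dual_def)
    qed
    show "i = j + Suc e \<and> K - (q + Suc e) \<le> j \<and> j \<le> K - (p + Suc e)"
      if "i \<le> K" "j \<le> K" "dual K b i = dual K a j" for i j
    proof -
      have "prod.swap (b (K - i)) = prod.swap (a (K - j))"
        using that(3) by (simp add: dual_def)
      then have "a (K - j) = b (K - i)"
        by (metis swap_swap)
      then have "K - j = K - i + Suc e" "p \<le> K - i" "K - i \<le> q"
        using only[of "K - j" "K - i"] by auto
      then show ?thesis
        using that(1,2) by auto
    qed
  qed
qed

end

section \<open>Equality of the two middle parts\<close>

locale overlapping_AB = overlapping_B +
  fixes a'
  assumes A': "is_A (shift_points K b S) K a'"
begin

lemmas a'_chain = is_A_chain[OF A'] and a'_mem = is_A_mem[OF A'] and a'_image = is_A_image[OF A']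

lemma a'_nw: "i < j \<Longrightarrow> j \<le> K \<Longrightarrow> a' j \<rhd> a' i"
  by (rule chain_nw[OF a'_chain])

lemma a'_down: "i \<le> K \<Longrightarrow> down Y i (a' i)"
  by (rule chain_down[OF a'_chain a'_image])

lemma swapped_overlapping_AB:
  "overlapping_AB (prod.swap ` S) K (dual K b) (dual K a) (K - (q + Suc e)) (K - (p + Suc e)) e
     (dual K a') (dual K b')"
proof -
  interpret D: overlapping "prod.swap ` S" K "dual K b" "dual K a" "K - (q + Suc e)" "K - (p + Suc e)" e
    by (rule swapped_overlapping)
  show ?thesis
    using is_B_dual[OF A'] is_A_dual[OF B'] by unfold_locales (simp_all add: swap_shift_points)
qed

lemma a'_outside:
  assumes "i \<le> K" "i < p + Suc e \<or> q + Suc e < i"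
  shows "a' i = a i"
proof -
  interpret D: overlapping_AB "prod.swap ` S" K "dual K b" "dual K a" "K - (q + Suc e)" "K - (p + Suc e)" e
      "dual K a'" "dual K b'"
    by (rule swapped_overlapping_AB)
  have "K - (p + Suc e) < K - i \<or> K - i < K - (q + Suc e)"
    using assms pq q by auto
  then have "dual K a' (K - i) = dual K a (K - i)"
    using D.b'_below[of "K - i"] D.b'_above[of "K - i"] by auto
  then have "prod.swap (a' i) = prod.swap (a i)"
    using assms(1) by (simp add: dual_def)
  then show ?thesis
    by (metis swap_swap)
qed

lemma a'_q: "a' (q + Suc e) = (fst (b (Suc q)), snd (b q))"
proof -
  interpret D: overlapping_AB "prod.swap ` S" K "dual K b" "dual K a" "K - (q + Suc e)" "K - (p + Suc e)" e
      "dual K a'" "dual K b'"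
    by (rule swapped_overlapping_AB)
  have "K - (K - (q + Suc e)) = q + Suc e" "K - (K - (q + Suc e) + e) = Suc q"
    using q by auto
  then have "prod.swap (a' (q + Suc e)) = (snd (a (q + Suc e)), fst (b (Suc q)))"
    using D.b'_p by (simp add: dual_def)
  then show ?thesis
    using common[of q] pq by (simp add: prod_eq_iff)
qed

text \<open>Inside the block both shifts move \<open>b r\<close> to the position of
  \<open>b (Suc r)\<close>, and both fix the letters outside A and B. So \<open>b'\<close>, chosen
  in \<open>Z\<close>, has its middle points in \<open>Y\<close> as well.\<close>

lemma b'_middle_in_Y:
  assumes "p \<le> r" "r < q"
  shows "b' (Suc r) \<in> Y"
proof -
  have "(fst (b (Suc r)), snd (a (Suc r + e))) \<in> Y"
    using shift_points_step[of r K b S] common[of r] assms q by simp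
  then show ?thesis
    using b'_middle[of "Suc r"] assms shift_points_old[of "b' (Suc r)" S b K] by auto
qed

lemma b'_middle_down:
  assumes "p \<le> r" "r < q"
  shows "down Y (r + Suc e) (b' (Suc r))"
  using assms
proof (induction r rule: dec_induct)
  case base
  have "fst (b p) < fst (a (p + e))"
    using common[of p] pq q a_nw[of "p + e" "p + Suc e"] by (simp add: nw_def)
  \<comment> \<open>\<open>b' p\<close> has the value of \<open>a (p + e)\<close> and is further
    left, so the chain can continue with \<open>a' (p + e)\<close> instead of
    \<open>b' p\<close>.\<close>
  then have "b' (Suc p) \<rhd> a' (p + e)"
    using b'_nw[of p "Suc p"] b'_p a'_outside[of "p + e"] pq q by (auto simp: nw_def)
  then show ?case
    using down_Suc[OF b'_middle_in_Y[OF _ base] _ a'_down[of "p + e"]] pq q by simp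
next
  case (step r)
  then show ?case
    using down_Suc[OF b'_middle_in_Y[of "Suc r"] b'_nw[of "Suc r" "Suc (Suc r)"]] q by simp
qed

text \<open>Extra rank would propagate up the chain \<open>b'\<close> to
  \<open>a' (q + Suc e)\<close>, whose rank is exact.\<close>

lemma b'_middle_not_down:
  assumes "p \<le> r" "r < q"
  shows "\<not> down Y (Suc (r + Suc e)) (b' (Suc r))"
  using less_imp_le[OF assms(2)] assms
proof (induction r rule: inc_induct)
  case (step r)
  show ?case
  proof
    assume down: "down Y (Suc (r + Suc e)) (b' (Suc r))"
    show False
    proof (cases "Suc r = q")
      case True
      have "a' (q + Suc e) \<rhd> b' q"
        using b'_nw[of q "Suc q"] b'_Suc_q a'_q snd_b'_q_less q by (auto simp: nw_def)
      then have "down Y (Suc (q + Suc e)) (a' (q + Suc e))"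
        using down True a'_mem q by (intro down_Suc[of _ _ "b' q"]) auto
      then show False
        using is_A_not_down[OF A' q] by simp
    next
      case False
      then have "Suc r < q"
        using step by simp
      then have "down Y (Suc (Suc r + Suc e)) (b' (Suc (Suc r)))"
        using down b'_middle_in_Y[of "Suc r"] b'_nw[of "Suc r" "Suc (Suc r)"] step.prems q
        by (intro down_Suc[of _ _ "b' (Suc r)"]) auto
      then show False
        using step \<open>Suc r < q\<close> by simp
    qed
  qed
qed simp

lemma a'_middle_up:
  assumes "p \<le> r" "r < q"
  shows "up Z (K - Suc r) (a' (r + Suc e))"
proof -
  interpret D: overlapping_AB "prod.swap ` S" K "dual K b" "dual K a" "K - (q + Suc e)" "K - (p + Suc e)" e
      "dual K a'" "dual K b'"
    by (rule swapped_overlapping_AB)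
  define j where "j = K - Suc (r + Suc e)"
  have j: "K - (q + Suc e) \<le> j" "j < K - (p + Suc e)" "K - Suc j = r + Suc e" "j + Suc e = K - Suc r"
    using assms q by (auto simp: j_def)
  have "dual K a' (Suc j) = prod.swap (a' (r + Suc e))"
    using j(3) by (simp add: dual_def)
  then have "down (prod.swap ` Z) (K - Suc r) (prod.swap (a' (r + Suc e)))"
    using D.b'_middle_down[OF j(1,2)] unfolding j(4) swap_shift_points by simp
  then show ?thesis
    by simp
qed

text \<open>\<open>a'\<close> is greedy in \<open>Y\<close> and \<open>b'\<close> in
  \<open>Z\<close>, so each has to be a candidate in the point set of the other:
  \<open>b'_middle_down\<close> and \<open>a'_middle_up\<close> provide the ranks. The coordinates
  are compared in \<open>Y\<close>.\<close>

lemma middle_eq: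
  assumes "p \<le> r" "r < q"
  shows "a' (r + Suc e) = b' (Suc r)"
proof (rule sandwich[of p "q - 1" "\<lambda>r. a' (r + Suc e)" "\<lambda>r. b' (Suc r)"])
  have *: "(fst (a' (r + Suc e)) \<le> fst (b' (Suc r)) \<longleftrightarrow> snd (a' (r + Suc e)) \<le> snd (b' (Suc r))) \<and>
      (fst (b' (Suc r)) \<le> fst (a' (r + Suc e)) \<longleftrightarrow> snd (b' (Suc r)) \<le> snd (a' (r + Suc e)))"
    if r: "p \<le> r" "r \<le> q - 1" for r
  proof -
    have "r < q" "r + Suc e \<le> K"
      using r assms q by auto
    then show ?thesis
      using down_level_coords[OF placement_Y] b'_middle_down[of r] b'_middle_not_down[of r] r
        a'_down[of "r + Suc e"] is_A_not_down[OF A', of "r + Suc e"] by blast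
  qed
  show "fst (a' (r + Suc e)) \<le> fst (b' (Suc r)) \<longleftrightarrow> snd (a' (r + Suc e)) \<le> snd (b' (Suc r))"
    "fst (b' (Suc r)) \<le> fst (a' (r + Suc e)) \<longleftrightarrow> snd (b' (Suc r)) \<le> snd (a' (r + Suc e))"
    if "p \<le> r" "r \<le> q - 1" for r
    using *[OF that] by auto
  show "snd (a' (q - 1 + Suc e)) \<le> snd (b' (Suc (q - 1)))"
  proof -
    obtain r where r: "q = Suc r" "p \<le> r"
      using assms by (cases q) auto
    \<comment> \<open>With \<open>q = Suc r\<close>, the end points \<open>a' (q + Suc e)\<close>
      and \<open>b' (Suc q)\<close> share a position, so \<open>b' q\<close> is a candidate for
      \<open>a' (r + Suc e)\<close>.\<close>
    have "fst (a' (Suc (r + Suc e))) < fst (b' (Suc r))"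
      using a'_q b'_Suc_q r b'_nw[of q "Suc q"] q by (simp add: nw_def)
    then have "snd (a' (r + Suc e)) \<le> snd (b' (Suc r))"
      using r b'_middle_down[of r] q by (intro is_A_step[OF A']) auto
    then show ?thesis
      using r by simp
  qed
  show "snd (a' (r + Suc e)) \<le> snd (b' (Suc r))"
    if r: "p \<le> r" "r < q - 1" "fst (a' (Suc r + Suc e)) \<le> fst (b' (Suc (Suc r)))" for r
  proof -
    have "r < q" "Suc (Suc r) \<le> K"
      using r(2) q by auto
    then show ?thesis
      using r b'_middle_down[of r] b'_nw[of "Suc r" "Suc (Suc r)"] q
      by (intro is_A_step[OF A']) (auto simp: nw_def)
  qed
  \<comment> \<open>The end points \<open>b' p\<close> and \<open>a' (p + e)\<close> share a value,
    so \<open>a' (p + Suc e)\<close> is a candidate for \<open>b' (Suc p)\<close>.\<close>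
  show "fst (b' (Suc p)) \<le> fst (a' (p + Suc e))"
    using a'_middle_up[of p] assms q b'_p a'_outside[of "p + e"] a'_nw[of "p + e" "p + Suc e"]
    by (intro is_B_step[OF B']) (auto simp: nw_def)
  show "fst (b' (Suc (Suc r))) \<le> fst (a' (Suc r + Suc e))"
    if r: "p \<le> r" "r < q - 1" "snd (b' (Suc r)) \<le> snd (a' (r + Suc e))" for r
  proof -
    have "Suc r < q" "Suc r + Suc e \<le> K"
      using r(2) q by auto
    then show ?thesis
      using r a'_middle_up[of "Suc r"] a'_nw[of "r + Suc e" "Suc r + Suc e"]
      by (intro is_B_step[OF B']) (auto simp: nw_def)
  qed
qed (use assms in auto)

end

subsection \<open>Commutation of the cycles\<close>

definition word :: "nat \<Rightarrow> (nat \<Rightarrow> nat) \<Rightarrow> nat list" where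
  "word K f = map f (rev [0..<Suc K])"

lemma length_word [simp]: "length (word K f) = Suc K"
  by (simp add: word_def)

lemma set_word [simp]: "set (word K f) = f ` {..K}"
  by (auto simp: word_def atLeast0LessThan lessThan_Suc_atMost simp del: upt_Suc)

lemma nth_word: "j \<le> K \<Longrightarrow> word K f ! j = f (K - j)"
  unfolding word_def by (simp add: rev_nth del: upt_Suc)

lemma distinct_word: "inj_on f {..K} \<Longrightarrow> distinct (word K f)"
  by (simp add: word_def distinct_map atLeast0LessThan lessThan_Suc_atMost del: upt_Suc)

lemma cycle_nth:
  fixes s :: "nat list"
  assumes "distinct s" "j < length s"
  shows "cycle_of_list s (s ! j) = s ! (Suc j mod length s)"
  using nth_shift[OF assms(1), of 0 "[s ! j]" j] assms(2) by (simp add: shift_def)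

lemma cycle_word_Suc:
  assumes "inj_on f {..K}" "i < K"
  shows "cycle_of_list (word K f) (f (Suc i)) = f i"
proof -
  have "cycle_of_list (word K f) (word K f ! (K - Suc i)) = word K f ! (Suc (K - Suc i) mod Suc K)"
    using cycle_nth[OF distinct_word[OF assms(1)], of "K - Suc i"] by simp
  then show ?thesis
    using assms(2) by (simp add: nth_word Suc_diff_Suc)
qed

lemma cycle_word_0: "inj_on f {..K} \<Longrightarrow> cycle_of_list (word K f) (f 0) = f K"
  using cycle_nth[OF distinct_word, of f K K] by (simp add: nth_word)

lemma cycle_word_other: "v \<notin> f ` {..K} \<Longrightarrow> cycle_of_list (word K f) v = v"
  by (rule id_outside_supp) simp

lemma cycles_commute_disjoint:
  assumes "inj_on x {..K}" "inj_on y {..K}" "x ` {..K} \<inter> y ` {..K} = {}"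
  shows "cycle_of_list (word K x) (cycle_of_list (word K y) v) = cycle_of_list (word K y) (cycle_of_list (word K x) v)"
proof -
  have *: "cycle_of_list (word K x) (cycle_of_list (word K y) v) = cycle_of_list (word K y) (cycle_of_list (word K x) v)"
    if "inj_on y {..K}" "x ` {..K} \<inter> y ` {..K} = {}" "v \<in> y ` {..K}" for x y :: "nat \<Rightarrow> nat" and v
  proof -
    have nx: "u \<notin> x ` {..K}" if "u \<in> y ` {..K}" for u
      using that \<open>x ` {..K} \<inter> y ` {..K} = {}\<close> by blast
    obtain i where i: "i \<le> K" "v = y i"
      using \<open>v \<in> y ` {..K}\<close> by auto
    have "cycle_of_list (word K y) v \<in> y ` {..K}"
      using i that(1) by (cases i) (auto simp: cycle_word_0 cycle_word_Suc)
    then show ?thesis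
      using nx that(3) by (simp add: cycle_word_other)
  qed
  show ?thesis
  proof (cases "v \<in> x ` {..K} \<or> v \<in> y ` {..K}")
    case True
    then show ?thesis
      using *[of y x v] *[of x y v] assms by (metis Int_commute)
  next
    case False
    then show ?thesis
      by (simp add: cycle_word_other)
  qed
qed

text \<open>Only values occur here. At index \<open>q + Suc e\<close> the point of A changes its
  position but not its value, which is why \<open>x'\<close> agrees with \<open>x\<close> from that
  index on.\<close>

lemma cycles_commute_overlapping:
  fixes x y x' y' :: "nat \<Rightarrow> nat"
  assumes inj: "inj_on x {..K}" "inj_on y {..K}" "inj_on x' {..K}" "inj_on y' {..K}"
    and pq: "p \<le> q" "q + Suc e \<le> K"
    and common: "\<And>r. p \<le> r \<Longrightarrow> r \<le> q \<Longrightarrow> x (r + Suc e) = y r"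
    and only: "\<And>i j. i \<le> K \<Longrightarrow> j \<le> K \<Longrightarrow> x i = y j \<Longrightarrow> i = j + Suc e \<and> p \<le> j \<and> j \<le> q"
    and x'_x: "\<And>i. i \<le> K \<Longrightarrow> i < p + Suc e \<or> q + Suc e \<le> i \<Longrightarrow> x' i = x i"
    and y'_y: "\<And>j. j \<le> K \<Longrightarrow> j < p \<or> q < j \<Longrightarrow> y' j = y j"
    and y'_p: "y' p = x (p + e)"
    and middle: "\<And>r. p \<le> r \<Longrightarrow> r < q \<Longrightarrow> x' (r + Suc e) = y' (Suc r)"
    and new: "\<And>r. p \<le> r \<Longrightarrow> r < q \<Longrightarrow> y' (Suc r) = y r \<or> y' (Suc r) \<notin> x ` {..K} \<and> y' (Suc r) \<notin> y ` {..K}"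
  shows "cycle_of_list (word K x') (cycle_of_list (word K y) v) =
    cycle_of_list (word K y') (cycle_of_list (word K x) v)"
proof -
  have y_eq: "i = j" if "y i = y j" "i \<le> K" "j \<le> K" for i j
    using inj(2) that by (auto simp: inj_on_def)
  have x_eq: "i = j" if "x i = x j" "i \<le> K" "j \<le> K" for i j
    using inj(1) that by (auto simp: inj_on_def)
  have mid_y: "r = j \<and> y' (Suc r) = y r" if "y' (Suc r) = y j" "p \<le> r" "r < q" "j \<le> K" for r j
    using new[OF that(2,3)] that y_eq[of r j] pq by auto
  have mid_x: "i = r + Suc e \<and> y' (Suc r) = y r" if "y' (Suc r) = x i" "p \<le> r" "r < q" "i \<le> K" for r i
    using new[OF that(2,3)] that only[of i r] pq by auto
  have x'_cases: "(i < p + Suc e \<or> q + Suc e \<le> i) \<and> x' i = x i \<or>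
      (\<exists>r. p \<le> r \<and> r < q \<and> i = r + Suc e \<and> x' i = y' (Suc r))" if "i \<le> K" for i
  proof (cases "i < p + Suc e \<or> q + Suc e \<le> i")
    case False
    then have "p \<le> i - Suc e" "i - Suc e < q" "i = i - Suc e + Suc e"
      by auto
    then show ?thesis
      using middle[of "i - Suc e"] by metis
  qed (use x'_x that in auto)
  have y'_cases: "(j < p \<or> q < j) \<and> y' j = y j \<or> j = p \<and> y' j = x (p + e) \<or>
      (\<exists>r. p \<le> r \<and> r < q \<and> j = Suc r)" if "j \<le> K" for j
  proof -
    consider "j < p \<or> q < j" | "j = p" | "p < j" "j \<le> q"
      by linarith
    then show ?thesis
    proof cases
      case 3
      then show ?thesis
        by (intro disjI2 exI[of _ "j - 1"]) auto
    qed (use y'_y y'_p that in auto)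
  qed
  have y_in_x': "j < q \<and> p \<le> j \<and> y' (Suc j) = y j \<or> j = q" if "x' i = y j" "i \<le> K" "j \<le> K" for i j
    using x'_cases[OF that(2)]
  proof (elim disjE exE)
    assume *: "(i < p + Suc e \<or> q + Suc e \<le> i) \<and> x' i = x i"
    then have "i = j + Suc e \<and> p \<le> j \<and> j \<le> q"
      using only[of i j] that by simp
    then show ?thesis
      using * by auto
  next
    fix r assume "p \<le> r \<and> r < q \<and> i = r + Suc e \<and> x' i = y' (Suc r)"
    then show ?thesis
      using mid_y[of r j] that by auto
  qed
  have y_in_y': "j < p \<or> q < j \<or> p \<le> j \<and> j < q \<and> y' (Suc j) = y j" if "y' k = y j" "k \<le> K" "j \<le> K" for k j
    using y'_cases[OF that(2)]
  proof (elim disjE exE)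
    assume "(k < p \<or> q < k) \<and> y' k = y k"
    then show ?thesis
      using y_eq[of k j] that by metis
  next
    assume "k = p \<and> y' k = x (p + e)"
    then show ?thesis
      using only[of "p + e" j] that pq by auto
  next
    fix r assume "p \<le> r \<and> r < q \<and> k = Suc r"
    then show ?thesis
      using mid_y[of r j] that by metis
  qed
  have x_in_y': "i = p + e \<or> x i \<in> y ` {..K}" if "y' k = x i" "k \<le> K" "i \<le> K" for k i
    using y'_cases[OF that(2)]
  proof (elim disjE exE)
    assume "(k < p \<or> q < k) \<and> y' k = y k"
    then show ?thesis
      using that by auto
  next
    assume "k = p \<and> y' k = x (p + e)"
    then show ?thesis
      using x_eq[of i "p + e"] that pq by auto
  next
    fix r assume r: "p \<le> r \<and> r < q \<and> k = Suc r"
    then have "x i = y r"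
      using mid_x[of r i] that by auto
    then show ?thesis
      using r pq by auto
  qed
  note cyc_simps = cycle_word_Suc[OF inj(1)] cycle_word_Suc[OF inj(2)]
    cycle_word_Suc[OF inj(3)] cycle_word_Suc[OF inj(4)]
    cycle_word_0[OF inj(1)] cycle_word_0[OF inj(2)] cycle_word_0[OF inj(3)] cycle_word_0[OF inj(4)]
  let ?x = "cycle_of_list (word K x)" and ?y = "cycle_of_list (word K y)"
  let ?x' = "cycle_of_list (word K x')" and ?y' = "cycle_of_list (word K y')"
  have x'_fix: "?x' (y j) = y j" if "j \<le> K" "j < p \<or> q < j \<or> y' (Suc j) \<noteq> y j \<and> j < q" for j
  proof (rule cycle_word_other)
    show "y j \<notin> x' ` {..K}"
      using y_in_x'[OF _ _ that(1)] that(2) pq by fastforce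
  qed
  have y'_fix_y: "?y' (y j) = y j" if "p \<le> j" "j \<le> q" "j = q \<or> y' (Suc j) \<noteq> y j" for j
  proof (rule cycle_word_other)
    show "y j \<notin> y' ` {..K}"
      using y_in_y'[of _ j] that pq by fastforce
  qed
  have y'_fix_x: "?y' (x i) = x i" if "i \<le> K" "x i \<notin> y ` {..K}" "i \<noteq> p + e" for i
  proof (rule cycle_word_other)
    show "x i \<notin> y' ` {..K}"
      using x_in_y'[OF _ _ that(1)] that by (metis atMost_iff imageE)
  qed
  have x_fix: "?x (y j) = y j" if "j \<le> K" "j < p \<or> q < j" for j
  proof (rule cycle_word_other)
    show "y j \<notin> x ` {..K}"
      using only[OF _ that(1)] that(2) by fastforce
  qed
  have y'_down: "?y' (y' (Suc r)) = y' r" and x'_down: "?x' (x' (Suc i)) = x' i"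
    if "r < K" "i < K" for r i
    using that by (simp_all add: cyc_simps)
  \<comment> \<open>On the middle letters both new cycles act alike; at \<open>r = p\<close> this is
    \<open>x' (p + e) = x (p + e) = y' p\<close>.\<close>
  have x'_mid: "?x' (y' (Suc r)) = y' r" if r: "p \<le> r" "r < q" for r
  proof -
    have "?x' (y' (Suc r)) = x' (r + e)"
      using middle[OF r] x'_down[of 0 "r + e"] r pq by simp
    also have "\<dots> = y' r"
    proof (cases "r = p")
      case True
      then show ?thesis
        using x'_x[of "p + e"] y'_p r pq by simp
    next
      case False
      then obtain s where "r = Suc s" "p \<le> s"
        using r by (cases r) auto
      then show ?thesis
        using middle[of s] r by simp
    qed
    finally show ?thesis .
  qed
  \<comment> \<open>\<open>x'\<close> and \<open>y'\<close> gain letters only in the middle, so a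
    letter outside \<open>x\<close> and \<open>y\<close> is some \<open>y' (Suc r)\<close> or is
    fixed by all four cycles.\<close>
  consider (y0) "v = y 0" | (yS) j where "j < K" "v = y (Suc j)" | (x) i where "i \<le> K" "v = x i" "v \<notin> y ` {..K}"
    | (mid) r where "p \<le> r" "r < q" "v = y' (Suc r)" "v \<notin> x ` {..K}" "v \<notin> y ` {..K}"
    | (none) "v \<notin> x ` {..K}" "v \<notin> y ` {..K}" "v \<notin> x' ` {..K}" "v \<notin> y' ` {..K}"
  proof -
    have "\<exists>j<K. v = y (Suc j)" if "v \<in> y ` {..K}" "v \<noteq> y 0"
    proof -
      obtain j where "j \<le> K" "v = y j"
        using \<open>v \<in> y ` {..K}\<close> by auto
      then show ?thesis
        using that(2) by (cases j) (auto simp: Suc_le_eq)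
    qed
    moreover have "\<exists>r. p \<le> r \<and> r < q \<and> v = y' (Suc r)"
      if "v \<in> x' ` {..K} \<or> v \<in> y' ` {..K}" "v \<notin> x ` {..K}" "v \<notin> y ` {..K}"
      using that(1)
    proof
      assume "v \<in> x' ` {..K}"
      then obtain i where "i \<le> K" "v = x' i"
        by auto
      then show ?thesis
        using x'_cases[of i] that by auto
    next
      assume "v \<in> y' ` {..K}"
      then obtain j where "j \<le> K" "v = y' j"
        by auto
      then show ?thesis
        using y'_cases[of j] that pq by auto
    qed
    ultimately show thesis
      using y0 yS x mid none by (metis atMost_iff imageE)
  qed
  then show ?thesis
  proof cases
    case y0
    have L: "?x' (?y v) = y K"
      using y0 x'_fix[of K] pq by (simp add: cyc_simps)
    have "?y' (?x v) = y K"
    proof (cases "p = 0")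
      case True
      then have "v = x (Suc e)"
        using y0 common[of 0] by simp
      then have "?x v = x (p + e)"
        using True pq by (simp add: cyc_simps)
      then have "?x v = y' 0"
        using y'_p True by simp
      then show ?thesis
        using y'_y[of K] pq by (simp add: cyc_simps)
    next
      case False
      then have "?x v = y' 0"
        using y0 x_fix[of 0] y'_y[of 0] by simp
      then show ?thesis
        using y'_y[of K] pq by (simp add: cyc_simps)
    qed
    then show ?thesis
      using L by simp
  next
    case (yS j)
    then have yv: "?y v = y j"
      by (simp add: cyc_simps)
    consider "Suc j < p" | "Suc j = p" | "p \<le> j" "j < q" | "j = q" | "q < j"
      by linarith
    then show ?thesis
    proof cases
      case 1
      then have "?x v = y' (Suc j)" "y j = y' j"
        using yS x_fix[of "Suc j"] y'_y[of "Suc j"] y'_y[of j] by auto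
      then show ?thesis
        using yv yS x'_fix[of j] 1 by (simp add: cyc_simps)
    next
      case 2
      then have "v = x (Suc (p + e))"
        using yS common[of p] pq by simp
      then have "?x v = y' (Suc j)"
        using 2 pq y'_p by (simp add: cyc_simps)
      then show ?thesis
        using yv yS x'_fix[of j] 2 y'_y[of j] y'_down[of j j] by simp
    next
      case 3
      then have "v = x (Suc (j + Suc e))"
        using yS common[of "Suc j"] by simp
      then have xv: "?x v = y j"
        using 3 pq common[of j] by (simp add: cyc_simps)
      \<comment> \<open>Both first cycles send \<open>v\<close> to \<open>y j\<close>. If this
        letter survives as \<open>y' (Suc j)\<close>, both second cycles send it to
        \<open>y' j\<close>; otherwise both fix it.\<close>
      show ?thesis
      proof (cases "y' (Suc j) = y j")
        case True
        then show ?thesis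
          using xv yv x'_mid[of j] y'_down[of j j] 3 yS by simp
      next
        case False
        then show ?thesis
          using xv yv x'_fix[of j] y'_fix_y[of j] 3 yS by simp
      qed
    next
      case 4
      have xv: "?x v = y' (Suc q)"
        using yS 4 x_fix[of "Suc q"] y'_y[of "Suc q"] by simp
      \<comment> \<open>The top letter of the block is still in \<open>x'\<close>, and its successor
        there is \<open>y' q\<close>; on the other side \<open>v\<close> is
        \<open>y' (Suc q)\<close>, with the same successor.\<close>
      have "y j = x' (Suc (q + e))"
        using 4 common[of q] x'_x[of "q + Suc e"] pq by simp
      then have "?x' (y j) = x' (q + e)"
        using x'_down[of 0 "q + e"] pq by simp
      also have "\<dots> = y' q"
      proof (cases "q = p")
        case True
        then show ?thesis
          using x'_x[of "p + e"] y'_p pq by simp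
      next
        case False
        then obtain s where "q = Suc s" "p \<le> s"
          using pq by (cases q) auto
        then show ?thesis
          using middle[of s] by simp
      qed
      finally show ?thesis
        using xv yv y'_down[of q q] pq by simp
    next
      case 5
      then have "?x v = y' (Suc j)" "y j = y' j"
        using yS x_fix[of "Suc j"] y'_y[of "Suc j"] y'_y[of j] by auto
      then show ?thesis
        using yv yS x'_fix[of j] 5 by (simp add: cyc_simps)
    qed
  next
    case (x i)
    have yv: "?y v = v"
      using x by (intro cycle_word_other)
    have not_mid: "\<not> (p + Suc e \<le> i \<and> i \<le> q + Suc e)"
    proof
      assume "p + Suc e \<le> i \<and> i \<le> q + Suc e"
      then have "p \<le> i - Suc e" "i - Suc e \<le> q" "i - Suc e + Suc e = i"
        by auto
      then have "x i = y (i - Suc e)" "i - Suc e \<le> K"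
        using common[of "i - Suc e"] pq by auto
      then show False
        using x by auto
    qed
    then have v: "v = x' i"
      using x x'_x[of i] by auto
    show ?thesis
    proof (cases i)
      case 0
      have "?x' v = x' K"
        unfolding v 0 by (rule cycle_word_0[OF inj(3)])
      then have xv: "?x v = x K" "?x' v = x K"
        using x(2) 0 x'_x[of K] pq by (simp_all add: cyc_simps)
      have "?y' (x K) = x K"
      proof (cases "K = q + Suc e")
        case True
        then show ?thesis
          using common[of q] y'_fix_y[of q] pq by simp
      next
        case False
        have "x K \<notin> y ` {..K}"
          using only[of K] pq False by fastforce
        then show ?thesis
          using y'_fix_x[of K] pq by auto
      qed
      then show ?thesis
        using xv yv by simp
    next
      case (Suc k)
      have "Suc k < p + Suc e \<or> q + Suc e \<le> k"
        using not_mid Suc by auto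
      moreover have "?x' v = x' k"
        unfolding v Suc by (rule cycle_word_Suc[OF inj(3)]) (use x(1) Suc in simp)
      ultimately have xv: "?x v = x k" "?x' v = x k"
        using x(1,2) Suc x'_x[of k] by (auto simp: cyc_simps)
      have "?y' (x k) = x k"
      proof (cases "k = q + Suc e")
        case True
        then show ?thesis
          using common[of q] y'_fix_y[of q] pq by simp
      next
        case False
        have "x k \<notin> y ` {..K}"
          using only[of k] x(1) Suc not_mid False by fastforce
        then show ?thesis
          using y'_fix_x[of k] x(1) Suc not_mid False pq by auto
      qed
      then show ?thesis
        using xv yv by simp
    qed
  next
    case (mid r)
    then show ?thesis
      using x'_mid[of r] y'_down[of r r] pq by (simp add: cycle_word_other)
  next
    case none
    then show ?thesis
      by (simp add: cycle_word_other)
  qed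
qed

subsection \<open>Existence and translation to words\<close>

lemma is_A_exists:
  assumes S: "finite S" and c: "chain K c" "c ` {..K} \<subseteq> S"
  obtains a where "is_A S K a"
proof -
  have least: "\<exists>x. x \<in> X \<and> (\<forall>y\<in>X. snd x \<le> snd y)" if "X \<subseteq> S" "X \<noteq> {}" for X :: "point set"
  proof -
    have "finite X"
      using that S finite_subset by blast
    then show ?thesis
      using that arg_min_if_finite[of X snd] by (metis not_le_imp_less)
  qed
  have below: "\<exists>f. f m = y \<and> (\<forall>i\<le>m. f i \<in> S) \<and> (\<forall>i<m. f (Suc i) \<rhd> f i \<and>
      (\<forall>x. down S i x \<longrightarrow> fst (f (Suc i)) < fst x \<longrightarrow> snd (f i) \<le> snd x))" if "down S m y" for m y
    using that
  proof (induction m arbitrary: y)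
    case 0
    then show ?case
      by (intro exI[of _ "\<lambda>_. y"]) auto
  next
    case (Suc m)
    then obtain z where z: "y \<rhd> z" "down S m z"
      by (auto simp: down.simps(2))
    have "{x. down S m x \<and> fst y < fst x} \<subseteq> S" "{x. down S m x \<and> fst y < fst x} \<noteq> {}"
      using z down_in by (auto simp: nw_def)
    from least[OF this] obtain x where x: "down S m x" "fst y < fst x"
        "\<forall>x'. down S m x' \<longrightarrow> fst y < fst x' \<longrightarrow> snd x \<le> snd x'"
      by blast
    \<comment> \<open>The candidates are not restricted in value, but \<open>z\<close> is one of
      them and lies below \<open>y\<close>, hence so does the minimum.\<close>
    then have yx: "y \<rhd> x"
      using z by (force simp: nw_def)
    obtain f where f: "f m = x" "\<forall>i\<le>m. f i \<in> S" "\<forall>i<m. f (Suc i) \<rhd> f i \<and>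
        (\<forall>x. down S i x \<longrightarrow> fst (f (Suc i)) < fst x \<longrightarrow> snd (f i) \<le> snd x)"
      using Suc.IH[OF x(1)] by blast
    show ?case
      using f x yx down_in[OF Suc.prems]
      by (intro exI[of _ "f(Suc m := y)"]) (auto simp: less_Suc_eq le_Suc_eq)
  qed
  have "down S K (c K)"
    by (rule chain_down[OF c order_refl])
  then have "{x. down S K x} \<subseteq> S" "{x. down S K x} \<noteq> {}"
    using down_in by auto
  from least[OF this] obtain y where y: "down S K y" "\<forall>x. down S K x \<longrightarrow> snd y \<le> snd x"
    by blast
  obtain f where "f K = y" "\<forall>i\<le>K. f i \<in> S" "\<forall>i<K. f (Suc i) \<rhd> f i \<and>
      (\<forall>x. down S i x \<longrightarrow> fst (f (Suc i)) < fst x \<longrightarrow> snd (f i) \<le> snd x)"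
    using below[OF y(1)] by blast
  then have "is_A S K f"
    using y(2) unfolding is_A_def chain_def by auto
  then show thesis
    by (rule that)
qed

lemma is_B_exists:
  assumes "finite S" "chain K c" "c ` {..K} \<subseteq> S"
  obtains b where "is_B S K b"
proof -
  obtain a where "is_A (prod.swap ` S) K a"
    using assms is_A_exists[of "prod.swap ` S" K "dual K c"]
    by (auto simp: chain_dual image_dual image_mono)
  then have "is_B S K (dual K a)"
    using is_B_dual by fastforce
  then show thesis
    by (rule that)
qed

section \<open>Permutations as point sets\<close>

definition points :: "nat list \<Rightarrow> point set" where
  "points \<pi> = {(i, \<pi> ! i) |i. i < length \<pi>}"

lemma placement_points: "distinct \<pi> \<Longrightarrow> placement (points \<pi>)"
proof -
  assume "distinct \<pi>"
  moreover have "points \<pi> = (\<lambda>i. (i, \<pi> ! i)) ` {..<length \<pi>}"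
    by (auto simp: points_def)
  then have "finite (points \<pi>)"
    by simp
  ultimately show ?thesis
    by (auto simp: placement_def points_def inj_on_def nth_eq_iff_index_eq)
qed

lemma subseq_map_snd_points:
  assumes "set ps \<subseteq> points \<pi>" "sorted_wrt (\<lambda>x y. fst x < fst y) ps"
  shows "subseq (map snd ps) \<pi>"
proof -
  \<comment> \<open>Cutting off a prefix lets the induction place each further point to the right of
    those already used.\<close>
  have "subseq (map snd ps) (drop n \<pi>)" if "\<forall>x\<in>set ps. n \<le> fst x" for n
    using that assms
  proof (induction ps arbitrary: n)
    case (Cons x ps)
    obtain i where x: "x = (i, \<pi> ! i)" "i < length \<pi>" "n \<le> i"
      using Cons.prems by (auto simp: points_def)
    have "subseq (map snd ps) (drop (Suc i) \<pi>)"
      using Cons.prems x by (intro Cons.IH) (auto simp: Suc_le_eq)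
    then have "subseq (map snd (x # ps)) (drop i \<pi>)"
      using x by (simp add: Cons_nth_drop_Suc[symmetric])
    moreover have "drop i \<pi> = drop (i - n) (drop n \<pi>)"
      using x by simp
    ultimately show ?case
      by (metis suffix_drop suffix_imp_subseq subseq_order.trans)
  qed simp
  from this[of 0] show ?thesis
    by simp
qed

lemma subseq_points:
  assumes "subseq xs \<pi>"
  obtains ps where "map snd ps = xs" "set ps \<subseteq> points \<pi>" "sorted_wrt (\<lambda>x y. fst x < fst y) ps"
proof -
  have "\<exists>ps. map snd ps = xs \<and> set ps \<subseteq> points \<pi> \<and> sorted_wrt (\<lambda>x y. fst x < fst y) ps"
    using assms
  proof (induction rule: list_emb.induct)
    case (list_emb_Nil ys)
    then show ?case
      by simp
  next
    case (list_emb_Cons xs ys y)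
    then obtain ps where ps: "map snd ps = xs" "set ps \<subseteq> points ys" "sorted_wrt (\<lambda>x y. fst x < fst y) ps"
      by blast
    then have "set (map (apfst Suc) ps) \<subseteq> points (y # ys)"
      by (force simp: points_def)
    then show ?case
      using ps by (intro exI[of _ "map (apfst Suc) ps"]) (simp add: sorted_wrt_map)
  next
    case (list_emb_Cons2 x y xs ys)
    then obtain ps where ps: "map snd ps = xs" "set ps \<subseteq> points ys" "sorted_wrt (\<lambda>x y. fst x < fst y) ps"
      by blast
    then have "set ((0, y) # map (apfst Suc) ps) \<subseteq> points (y # ys)"
      by (force simp: points_def)
    then show ?case
      using ps list_emb_Cons2 by (intro exI[of _ "(0, y) # map (apfst Suc) ps"]) (simp add: sorted_wrt_map)
  qed
  then show thesis
    using that by blast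
qed

lemma dec_subseqs_points:
  "dec_subseqs k \<pi> = map snd ` {ps. length ps = k \<and> set ps \<subseteq> points \<pi> \<and> sorted_wrt (\<rhd>) ps}"
proof (intro equalityI subsetI)
  fix xs assume "xs \<in> dec_subseqs k \<pi>"
  then have xs: "subseq xs \<pi>" "sorted_wrt (>) xs" "length xs = k"
    by (auto simp: dec_subseqs_def)
  obtain ps where ps: "map snd ps = xs" "set ps \<subseteq> points \<pi>" "sorted_wrt (\<lambda>x y. fst x < fst y) ps"
    using subseq_points[OF xs(1)] by blast
  then have "sorted_wrt (\<rhd>) ps"
    using xs(2) by (auto simp: sorted_wrt_iff_nth_less nw_def)
  then show "xs \<in> map snd ` {ps. length ps = k \<and> set ps \<subseteq> points \<pi> \<and> sorted_wrt (\<rhd>) ps}"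
    using ps xs(3) by auto
next
  fix xs assume "xs \<in> map snd ` {ps. length ps = k \<and> set ps \<subseteq> points \<pi> \<and> sorted_wrt (\<rhd>) ps}"
  then obtain ps where ps: "xs = map snd ps" "length ps = k" "set ps \<subseteq> points \<pi>" "sorted_wrt (\<rhd>) ps"
    by auto
  have "sorted_wrt (\<lambda>x y. fst x < fst y) ps"
    using ps(4) by (rule sorted_wrt_mono_rel[rotated]) (simp add: nw_def)
  then show "xs \<in> dec_subseqs k \<pi>"
    using ps subseq_map_snd_points[OF ps(3)]
    by (auto simp: dec_subseqs_def sorted_wrt_iff_nth_less nw_def)
qed

lemma down_hd:
  assumes "set (x # ps) \<subseteq> S" "sorted_wrt (\<rhd>) (x # ps)"
  shows "down S (length ps) x"
  using assms
proof (induction ps arbitrary: x)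
  case (Cons y ps)
  then show ?case
    using down_Suc[of x S y "length ps"] by simp
qed simp

lemma up_nth:
  assumes "set ps \<subseteq> S" "sorted_wrt (\<rhd>) ps" "i < length ps"
  shows "up S i (ps ! i)"
  using assms(3)
proof (induction i)
  case 0
  then show ?case
    using assms(1) by auto
next
  case (Suc i)
  then have "ps ! i \<rhd> ps ! Suc i" "ps ! Suc i \<in> S" "up S i (ps ! i)"
    using assms by (auto simp: sorted_wrt_iff_nth_less subset_iff)
  then show ?case
    by (intro up_Suc)
qed

lemma sorted_wrt_chain: "chain K c \<Longrightarrow> n \<le> Suc K \<Longrightarrow> sorted_wrt (\<rhd>) (map c (rev [0..<n]))"
  by (auto simp: sorted_wrt_iff_nth_less rev_nth intro!: chain_nw)

abbreviation letters :: "nat \<Rightarrow> (nat \<Rightarrow> point) \<Rightarrow> nat list" where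
  "letters K c \<equiv> word K (\<lambda>i. snd (c i))"

lemma letters_in_dec_subseqs:
  assumes "chain K c" "c ` {..K} \<subseteq> points \<pi>"
  shows "letters K c \<in> dec_subseqs (Suc K) \<pi>"
proof -
  have "letters K c = map snd (map c (rev [0..<Suc K]))"
    by (simp add: word_def comp_def del: upt_Suc)
  moreover have "set (map c (rev [0..<Suc K])) \<subseteq> points \<pi>"
    using assms(2) by (simp add: atLeast0LessThan lessThan_Suc_atMost del: upt_Suc)
  ultimately show ?thesis
    unfolding dec_subseqs_points using sorted_wrt_chain[OF assms(1), of "Suc K"]
    by (metis (mono_tags, lifting) diff_zero imageI length_map length_rev length_upt mem_Collect_eq order_refl)
qed

lemma dec_subseqs_chain:
  assumes "dec_subseqs (Suc K) \<pi> \<noteq> {}"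
  obtains c where "chain K c" "c ` {..K} \<subseteq> points \<pi>"
proof -
  obtain ps where ps: "length ps = Suc K" "set ps \<subseteq> points \<pi>" "sorted_wrt (\<rhd>) ps"
    using assms by (auto simp: dec_subseqs_points)
  have "chain K (\<lambda>i. ps ! (K - i))"
    using ps unfolding chain_def by (auto simp: sorted_wrt_iff_nth_less)
  moreover have "(\<lambda>i. ps ! (K - i)) ` {..K} \<subseteq> points \<pi>"
    using ps by (auto simp: subset_iff)
  ultimately show thesis
    using that by blast
qed

text \<open>The greedy choice bounds the first letter of any rival. If the first letters agree then,
  values being distinct, so do the points, and the remaining letters compete from the same
  position.\<close>

lemma A_seq_eq:
  assumes S: "distinct \<pi>" and A: "is_A (points \<pi>) K a"
  shows "A_seq (Suc K) \<pi> = letters K a"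
proof -
  have min: "letters m a \<le> map snd ps"
    if "m \<le> K" "length ps = Suc m" "set ps \<subseteq> points \<pi>" "sorted_wrt (\<rhd>) ps"
      "m < K \<Longrightarrow> fst (a (Suc m)) < fst (hd ps)" for m ps
    using that
  proof (induction m arbitrary: ps)
    case (0 ps)
    then obtain x where x: "ps = [x]"
      by (auto simp: length_Suc_conv)
    then have "snd (a 0) \<le> snd x"
      using 0 is_A_top[OF A, of x] is_A_step[OF A, of 0 x] by (cases "0 < K") auto
    then show ?case
      using x by (auto simp: word_def le_less)
  next
    case (Suc m ps)
    then obtain x y ps' where ps: "ps = x # y # ps'"
      by (auto simp: length_Suc_conv)
    have letters_Suc: "letters (Suc m) a = snd (a (Suc m)) # letters m a"
      by (simp add: word_def)
    have "down (points \<pi>) (Suc m) x"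
      using Suc.prems down_hd[of x "y # ps'" "points \<pi>"] ps by simp
    then have le: "snd (a (Suc m)) \<le> snd x"
      using Suc.prems ps is_A_top[OF A, of x] is_A_step[OF A, of "Suc m" x] by (cases "Suc m < K") auto
    show ?case
    proof (cases "snd (a (Suc m)) = snd x")
      case True
      then have "a (Suc m) = x"
        using snd_eqD[OF placement_points[OF S] is_A_mem[OF A]] Suc.prems ps by simp
      then have "letters m a \<le> map snd (y # ps')"
        using Suc.prems ps by (intro Suc.IH) (auto simp: nw_def)
      then show ?thesis
        using letters_Suc ps True by simp
    next
      case False
      then show ?thesis
        using letters_Suc ps le by simp
    qed
  qed
  show ?thesis
    unfolding A_seq_def
  proof (rule Min_eqI[OF finite_dec_subseqs])
    show "letters K a \<in> dec_subseqs (Suc K) \<pi>"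
      using A by (intro letters_in_dec_subseqs) (auto simp: is_A_def)
    show "letters K a \<le> xs" if "xs \<in> dec_subseqs (Suc K) \<pi>" for xs
      using that min[of K] by (auto simp: dec_subseqs_points)
  qed
qed

lemma leftmost_eq:
  assumes "i < length \<pi>" "P (\<pi> ! i)" "\<And>j. j < length \<pi> \<Longrightarrow> P (\<pi> ! j) \<Longrightarrow> i \<le> j"
  shows "leftmost P \<pi> = \<pi> ! i"
proof -
  have "\<not> P (\<pi> ! j)" if "j < i" for j
    using assms(1) assms(3)[of j] that by auto
  then have "filter P (take i \<pi>) = []"
    by (auto simp: filter_empty_conv in_set_conv_nth)
  then have "filter P \<pi> = filter P (drop i \<pi>)"
    by (metis append_Nil append_take_drop_id filter_append)
  then show ?thesis
    using assms(1,2) by (simp add: leftmost_def Cons_nth_drop_Suc[symmetric])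
qed

text \<open>\<open>letters K b\<close> shows that each \<open>b j\<close> is admissible. In any
  rival subsequence, the \<open>K - j\<close> letters before the chosen one give its
  \<open>up\<close> rank, so the greedy property of \<open>b\<close> applies.\<close>

lemma B_suffix_eq:
  assumes S: "distinct \<pi>" and B: "is_B (points \<pi>) K b" and j: "j \<le> Suc K"
  shows "B_suffix (Suc K) \<pi> j = map (\<lambda>i. snd (b i)) (rev [0..<j])"
  using j
proof (induction j)
  case (Suc j)
  define P where "P = (\<lambda>v. \<exists>xs\<in>dec_subseqs (Suc K) \<pi>. suffix (v # B_suffix (Suc K) \<pi> j) xs)"
  have IH: "B_suffix (Suc K) \<pi> j = map (\<lambda>i. snd (b i)) (rev [0..<j])"
    using Suc by simp
  obtain i where i: "i < length \<pi>" "b j = (i, \<pi> ! i)"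
    using is_B_mem[OF B, of j] Suc.prems by (auto simp: points_def)
  have "suffix (map (\<lambda>i. snd (b i)) (rev [0..<Suc j])) (letters K b)"
  proof -
    have "[0..<Suc K] = [0..<Suc j] @ [Suc j..<Suc K]"
      using Suc.prems upt_add_eq_append[of 0 "Suc j" "K - j"] by (simp del: upt_Suc)
    then show ?thesis
      by (simp add: word_def suffix_def del: upt_Suc)
  qed
  then have "suffix (\<pi> ! i # B_suffix (Suc K) \<pi> j) (letters K b)"
    using i IH by simp
  then have Pi: "P (\<pi> ! i)"
    unfolding P_def using letters_in_dec_subseqs[of K b \<pi>] B by (auto simp: is_B_def)
  have "i \<le> i'" if i': "i' < length \<pi>" "P (\<pi> ! i')" for i'
  proof -
    obtain ps where ps: "length ps = Suc K" "set ps \<subseteq> points \<pi>" "sorted_wrt (\<rhd>) ps"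
        "suffix (\<pi> ! i' # B_suffix (Suc K) \<pi> j) (map snd ps)"
      using i'(2) by (auto simp: P_def dec_subseqs_points)
    then obtain zs where zs: "map snd ps = zs @ \<pi> ! i' # map (\<lambda>i. snd (b i)) (rev [0..<j])"
      unfolding IH by (auto simp: suffix_def)
    have len: "length zs = K - j"
      using arg_cong[OF zs, of length] ps(1) by simp
    have snd_eq: "snd (ps ! (K - j)) = \<pi> ! i'"
      using arg_cong[OF zs, of "\<lambda>l. l ! (K - j)"] ps(1) len by (simp add: nth_append)
    have "(i', \<pi> ! i') \<in> points \<pi>"
      using i' by (auto simp: points_def)
    \<comment> \<open>Suffixes are compared as letters only; distinctness recovers the point and
      hence its position.\<close>
    then have x: "ps ! (K - j) = (i', \<pi> ! i')"
      using snd_eq ps(1,2) by (intro snd_eqD[OF placement_points[OF S]]) auto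
    then have up: "up (points \<pi>) (K - j) (i', \<pi> ! i')"
      using up_nth[OF ps(2,3), of "K - j"] ps(1) by simp
    show "i \<le> i'"
    proof (cases j)
      case 0
      then show ?thesis
        using is_B_bot[OF B, of "(i', \<pi> ! i')"] up i by simp
    next
      case (Suc l)
      have "snd (ps ! Suc (K - j)) = snd (b l)"
        using arg_cong[OF zs, of "\<lambda>xs. xs ! Suc (K - j)"] ps(1) len Suc Suc.prems
        by (simp add: nth_append rev_nth)
      moreover have "ps ! (K - j) \<rhd> ps ! Suc (K - j)"
        using ps(1,3) Suc \<open>Suc j \<le> Suc K\<close> by (simp add: sorted_wrt_iff_nth_less)
      ultimately have "snd (b l) < snd (i', \<pi> ! i')"
        using x by (simp add: nw_def)
      then show ?thesis
        using is_B_step[OF B, of l "(i', \<pi> ! i')"] up Suc \<open>Suc j \<le> Suc K\<close> i by simp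
    qed
  qed
  then have "leftmost P \<pi> = \<pi> ! i"
    using i(1) Pi by (intro leftmost_eq) auto
  then have "B_suffix (Suc K) \<pi> (Suc j) = \<pi> ! i # B_suffix (Suc K) \<pi> j"
    by (simp add: P_def)
  then show ?case
    using i IH by simp
qed simp

lemma B_seq_eq: "distinct \<pi> \<Longrightarrow> is_B (points \<pi>) K b \<Longrightarrow> B_seq (Suc K) \<pi> = letters K b"
  unfolding B_seq_def word_def by (rule B_suffix_eq) auto

lemma inj_on_snd_chain: "chain K c \<Longrightarrow> inj_on (\<lambda>i. snd (c i)) {..K}"
  by (rule inj_onI) (metis atMost_iff chain_snd_less less_irrefl linorder_neqE_nat)

lemma points_shift:
  assumes S: "distinct \<pi>" and c: "chain K c" "c ` {..K} \<subseteq> points \<pi>"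
  shows "points (shift (letters K c) \<pi>) = shift_points K c (points \<pi>)"
proof -
  let ?s = "cycle_of_list (letters K c)"
  note inj = inj_on_snd_chain[OF c(1)]
  have points_eq: "points (shift (letters K c) \<pi>) = (\<lambda>x. (fst x, ?s (snd x))) ` points \<pi>"
    by (force simp: points_def shift_def)
  have other: "(\<lambda>x. (fst x, ?s (snd x))) ` (points \<pi> - c ` {..K}) = points \<pi> - c ` {..K}"
  proof -
    have "?s (snd x) = snd x" if "x \<in> points \<pi> - c ` {..K}" for x
    proof (rule cycle_word_other)
      show "snd x \<notin> (\<lambda>i. snd (c i)) ` {..K}"
      proof
        assume "snd x \<in> (\<lambda>i. snd (c i)) ` {..K}"
        then obtain i where i: "i \<le> K" "snd x = snd (c i)"
          by auto
        then have "x = c i"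
          using that c(2) by (intro snd_eqD[OF placement_points[OF S]]) auto
        then show False
          using that i(1) by auto
      qed
    qed
    then show ?thesis
      by (simp add: image_def)
  qed
  have "{..K} = insert 0 (Suc ` {..<K})"
    by (simp add: lessThan_Suc_atMost[symmetric] lessThan_Suc_eq_insert_0)
  then have "(\<lambda>x. (fst x, ?s (snd x))) ` c ` {..K} =
      insert (fst (c 0), snd (c K)) ((\<lambda>i. (fst (c (Suc i)), ?s (snd (c (Suc i))))) ` {..<K})"
    using cycle_word_0[OF inj] by (simp add: image_image)
  also have "(\<lambda>i. (fst (c (Suc i)), ?s (snd (c (Suc i))))) ` {..<K} = {(fst (c (Suc i)), snd (c i)) |i. i < K}"
    using cycle_word_Suc[OF inj] by (auto simp: image_iff)
  finally have new: "(\<lambda>x. (fst x, ?s (snd x))) ` c ` {..K} =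
      insert (fst (c 0), snd (c K)) {(fst (c (Suc i)), snd (c i)) |i. i < K}" .
  have "points \<pi> = (points \<pi> - c ` {..K}) \<union> c ` {..K}"
    using c(2) by blast
  then have "(\<lambda>x. (fst x, ?s (snd x))) ` points \<pi> =
      (\<lambda>x. (fst x, ?s (snd x))) ` (points \<pi> - c ` {..K}) \<union> (\<lambda>x. (fst x, ?s (snd x))) ` c ` {..K}"
    by (metis image_Un)
  then show ?thesis
    unfolding points_eq shift_points_def other new by simp
qed

lemma distinct_shift:
  assumes "distinct \<pi>" "inj_on f {..K}"
  shows "distinct (shift (word K f) \<pi>)"
proof -
  have "inj (cycle_of_list (word K f))"
    using cycle_permutes by (metis permutes_inj)
  then show ?thesis
    using assms(1) by (simp add: shift_def distinct_map inj_on_def)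
qed

section \<open>Disjoint sequences, existence after a shift, and assembly\<close>

context AB_chains
begin

text \<open>A rival further left than a letter of B lies left of \<open>a 0\<close>. Its old point
  has the same position, no smaller value and the same \<open>up\<close> rank, so it was a rival
  already in \<open>S\<close>.\<close>

lemma disjoint_is_B:
  assumes "a ` {..K} \<inter> b ` {..K} = {}"
  shows "is_B (shift_points K a S) K b"
proof -
  have "a 0 \<noteq> b 0"
    using assms by auto
  then have "fst (b 0) \<noteq> fst (a 0)"
    using fst_eqD[OF S b_mem a_mem, of 0 0] by auto
  then have b0: "fst (b 0) < fst (a 0)"
    using fst_b0_le by simp
  have "b ` {..K} \<subseteq> shift_points K a S"
    using assms b_mem by (auto intro!: shift_points_old)
  moreover have "fst (b 0) \<le> fst z" if z: "up (shift_points K a S) K z" for z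
  proof (rule ccontr)
    assume less: "\<not> fst (b 0) \<le> fst z"
    then have "fst z < fst (a 0)"
      using b0 by simp
    then obtain x where "fst x = fst z" "up S K x"
      using up_shift_points[OF S A z] by blast
    then show False
      using less is_B_bot[OF B, of x] by simp
  qed
  moreover have "fst (b (Suc j)) \<le> fst z"
    if j: "j < K" and z: "up (shift_points K a S) (K - Suc j) z" "snd (b j) < snd z" for j z
  proof (rule ccontr)
    assume less: "\<not> fst (b (Suc j)) \<le> fst z"
    moreover have "fst (b (Suc j)) < fst (b 0)"
      using b_nw[of 0 "Suc j"] j by (simp add: nw_def)
    ultimately have "fst z < fst (a 0)"
      using b0 by simp
    then obtain x where "fst x = fst z" "snd z \<le> snd x" "up S (K - Suc j) x"
      using up_shift_points[OF S A z(1)] by blast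
    then show False
      using less is_B_step[OF B j, of x] z(2) by simp
  qed
  ultimately show ?thesis
    using b_chain by (simp add: is_B_def)
qed

lemma disjoint_is_A:
  assumes "a ` {..K} \<inter> b ` {..K} = {}"
  shows "is_A (shift_points K b S) K a"
proof -
  interpret D: AB_chains "prod.swap ` S" K "dual K b" "dual K a"
    by (rule swapped)
  have "is_B (prod.swap ` shift_points K b S) K (dual K a)"
    unfolding swap_shift_points
    by (rule D.disjoint_is_B) (use assms in \<open>simp add: image_dual image_Int[symmetric] Int_commute\<close>)
  from is_A_dual[OF this] have "is_A (shift_points K b S) K (dual K (dual K a))"
    by simp
  \<comment> \<open>\<open>dual\<close> is an involution only on indices up to \<open>K\<close>;
    \<open>is_A\<close> mentions no others.\<close>
  then show ?thesis
    unfolding is_A_def chain_def by (auto simp: dual_dual image_subset_iff)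
qed

end

text \<open>\<open>w\<close> is a chain of full length that survives the A-shift.\<close>

lemma (in overlapping) is_B_Z_exists: "\<exists>b'. is_B Z K b'"
  using is_B_exists[OF _ w_chain w_image] placement_Z by (metis placement_def)

lemma (in overlapping) is_A_Y_exists: "\<exists>a'. is_A Y K a'"
proof -
  interpret D: overlapping "prod.swap ` S" K "dual K b" "dual K a" "K - (q + Suc e)" "K - (p + Suc e)" e
    by (rule swapped_overlapping)
  obtain b' where "is_B (prod.swap ` Y) K b'"
    using D.is_B_Z_exists unfolding swap_shift_points by blast
  from is_A_dual[OF this] show ?thesis
    by auto
qed

lemma (in overlapping_AB) cycles_commute:
  "cycle_of_list (letters K a') (cycle_of_list (letters K b) v) =
   cycle_of_list (letters K b') (cycle_of_list (letters K a) v)"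
proof (rule cycles_commute_overlapping[of "\<lambda>i. snd (a i)" K "\<lambda>i. snd (b i)" "\<lambda>i. snd (a' i)" "\<lambda>i. snd (b' i)" p q e])
  show "inj_on (\<lambda>i. snd (a i)) {..K}" "inj_on (\<lambda>i. snd (b i)) {..K}"
    "inj_on (\<lambda>i. snd (a' i)) {..K}" "inj_on (\<lambda>i. snd (b' i)) {..K}"
    by (rule inj_on_snd_chain, rule a_chain b_chain a'_chain b'_chain)+
  show "p \<le> q" "q + Suc e \<le> K"
    by (rule pq, rule q)
  show "snd (a (r + Suc e)) = snd (b r)" if "p \<le> r" "r \<le> q" for r
    using common[OF that] by simp
  show "i = j + Suc e \<and> p \<le> j \<and> j \<le> q" if "i \<le> K" "j \<le> K" "snd (a i) = snd (b j)" for i j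
    using that snd_eqD[OF S a_mem b_mem, of i j] by (intro only) auto
  show "snd (a' i) = snd (a i)" if "i \<le> K" "i < p + Suc e \<or> q + Suc e \<le> i" for i
  proof (cases "i = q + Suc e")
    case True
    then show ?thesis
      using a'_q common[of q] pq by simp
  next
    case False
    then show ?thesis
      using a'_outside[of i] that by auto
  qed
  show "snd (b' j) = snd (b j)" if "j \<le> K" "j < p \<or> q < j" for j
    using that b'_below[of j] b'_above[of j] by auto
  show "snd (b' p) = snd (a (p + e))"
    by (simp add: b'_p)
  show "snd (a' (r + Suc e)) = snd (b' (Suc r))" if "p \<le> r" "r < q" for r
    using middle_eq[OF that] by simp
  show "snd (b' (Suc r)) = snd (b r) \<or>
      snd (b' (Suc r)) \<notin> (\<lambda>i. snd (a i)) ` {..K} \<and> snd (b' (Suc r)) \<notin> (\<lambda>i. snd (b i)) ` {..K}"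
    if r: "p \<le> r" "r < q" for r
  proof -
    consider "b' (Suc r) = (fst (b (Suc r)), snd (a (Suc r + e)))"
      | "b' (Suc r) \<in> S \<and> b' (Suc r) \<notin> a ` {..K} \<and> b' (Suc r) \<notin> b ` {..K}"
      using b'_middle[of "Suc r"] r by auto
    then show ?thesis
    proof cases
      assume "b' (Suc r) = (fst (b (Suc r)), snd (a (Suc r + e)))"
      then show ?thesis
        using common[of r] r by simp
    next
      assume *: "b' (Suc r) \<in> S \<and> b' (Suc r) \<notin> a ` {..K} \<and> b' (Suc r) \<notin> b ` {..K}"
      have "b' (Suc r) \<in> c ` {..K}"
        if c: "c ` {..K} \<subseteq> S" "snd (b' (Suc r)) \<in> (\<lambda>i. snd (c i)) ` {..K}" for c
      proof -
        obtain i where "i \<le> K" "snd (b' (Suc r)) = snd (c i)"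
          using c(2) by auto
        then have "b' (Suc r) = c i"
          using * c(1) by (intro snd_eqD[OF S]) auto
        then show ?thesis
          using \<open>i \<le> K\<close> by auto
      qed
      then show ?thesis
        using * a_image b_image by blast
    qed
  qed
qed

theorem theorem32:
  fixes k n :: nat and \<pi> :: "nat list"
  assumes "k \<ge> 2"
    and "\<pi> \<in> permutations_of_set {1..n}"
    and "dec_subseqs k \<pi> \<noteq> {}"
    and "A_seq k \<pi> \<noteq> B_seq k \<pi>"
  shows "dec_subseqs k (A_shift k \<pi>) \<noteq> {} \<and>
         dec_subseqs k (B_shift k \<pi>) \<noteq> {} \<and>
         A_shift k (B_shift k \<pi>) = B_shift k (A_shift k \<pi>)"
proof -
  obtain K where K: "k = Suc K"
    using assms(1) by (cases k) auto
  have dist: "distinct \<pi>"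
    using assms(2) by (simp add: permutations_of_set_def)
  define S where "S = points \<pi>"
  have S: "placement S"
    unfolding S_def by (rule placement_points[OF dist])
  obtain c where c: "chain K c" "c ` {..K} \<subseteq> S"
    using dec_subseqs_chain[of K \<pi>] assms(3) unfolding K S_def by blast
  obtain a where A: "is_A S K a"
    using is_A_exists[OF _ c] S by (metis placement_def)
  obtain b where B: "is_B S K b"
    using is_B_exists[OF _ c] S by (metis placement_def)
  interpret AB_chains S K a b
    using S A B by unfold_locales
  have seqs: "A_seq k \<pi> = letters K a" "B_seq k \<pi> = letters K b"
    using A_seq_eq[OF dist] B_seq_eq[OF dist] A B by (simp_all add: K S_def)
  \<comment> \<open>One letter with the same index in both sequences would force them to
    coincide.\<close>
  have distinct_ab: "\<forall>i\<le>K. a i \<noteq> b i"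
  proof (intro allI impI notI)
    fix i assume "i \<le> K" "a i = b i"
    then have "letters K a = letters K b"
      using eq_if_common[of i] by (intro nth_equalityI) (simp_all add: nth_word)
    then show False
      using assms(4) seqs by simp
  qed
  \<comment> \<open>Both cases deliver the sequences after one shift and the identity of cycles;
    that these sequences exist already yields the surviving decreasing subsequences.\<close>
  have "\<exists>a' b'. is_A (shift_points K b S) K a' \<and> is_B (shift_points K a S) K b' \<and>
      (\<forall>v. cycle_of_list (letters K a') (cycle_of_list (letters K b) v) =
           cycle_of_list (letters K b') (cycle_of_list (letters K a) v))"
  proof (cases "\<exists>i\<le>K. \<exists>j\<le>K. a i = b j")
    case True
    obtain p q d where *: "0 < d" "p \<le> q" "q + d \<le> K"
      "\<And>r. p \<le> r \<Longrightarrow> r \<le> q \<Longrightarrow> a (r + d) = b r"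
      "\<And>i j. i \<le> K \<Longrightarrow> j \<le> K \<Longrightarrow> a i = b j \<Longrightarrow> i = j + d \<and> p \<le> j \<and> j \<le> q"
      by (rule common_structure[OF distinct_ab True]) (rule that)
    obtain e where d: "d = Suc e"
      using *(1) not0_implies_Suc by blast
    interpret overlapping S K a b p q e
      by unfold_locales (fact *(2-)[unfolded d])+
    obtain a' b' where AB': "is_A Y K a'" "is_B Z K b'"
      using is_A_Y_exists is_B_Z_exists by blast
    then interpret overlapping_AB S K a b p q e b' a'
      by unfold_locales
    show ?thesis
      using AB' cycles_commute by blast
  next
    case False
    have disj: "a ` {..K} \<inter> b ` {..K} = {}"
    proof (rule equals0I)
      fix x assume "x \<in> a ` {..K} \<inter> b ` {..K}"
      then obtain i j where "i \<le> K" "x = a i" "j \<le> K" "x = b j"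
        by blast
      then show False
        using False by metis
    qed
    have "snd (a i) \<noteq> snd (b j)" if "i \<le> K" "j \<le> K" for i j
      using False that snd_eqD[OF S a_mem b_mem] by blast
    then have "(\<lambda>i. snd (a i)) ` {..K} \<inter> (\<lambda>i. snd (b i)) ` {..K} = {}"
      by auto
    then show ?thesis
      using disjoint_is_A[OF disj] disjoint_is_B[OF disj]
        cycles_commute_disjoint[OF inj_on_snd_chain[OF a_chain] inj_on_snd_chain[OF b_chain]] by blast
  qed
  then obtain a' b' where a': "is_A (shift_points K b S) K a'" and b': "is_B (shift_points K a S) K b'"
    and comm: "\<And>v. cycle_of_list (letters K a') (cycle_of_list (letters K b) v) =
           cycle_of_list (letters K b') (cycle_of_list (letters K a) v)"
    by blast
  have shifts: "A_shift k \<pi> = shift (letters K a) \<pi>" "B_shift k \<pi> = shift (letters K b) \<pi>"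
    using assms(3) seqs by (simp_all add: A_shift_def B_shift_def)
  have points_A: "points (A_shift k \<pi>) = shift_points K a S"
    and points_B: "points (B_shift k \<pi>) = shift_points K b S"
    unfolding shifts S_def using a_image b_image
    by (auto intro!: points_shift[OF dist] a_chain b_chain simp: S_def)
  have dist_A: "distinct (A_shift k \<pi>)" and dist_B: "distinct (B_shift k \<pi>)"
    unfolding shifts by (auto intro!: distinct_shift dist inj_on_snd_chain a_chain b_chain)
  have ne_A: "dec_subseqs k (A_shift k \<pi>) \<noteq> {}"
    using letters_in_dec_subseqs[OF is_B_chain[OF b'], of "A_shift k \<pi>"] is_B_image[OF b'] points_A
    by (metis K empty_iff)
  have ne_B: "dec_subseqs k (B_shift k \<pi>) \<noteq> {}"
    using letters_in_dec_subseqs[OF is_A_chain[OF a'], of "B_shift k \<pi>"] is_A_image[OF a'] points_B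
    by (metis K empty_iff)
  have "A_seq k (B_shift k \<pi>) = letters K a'"
    using A_seq_eq[OF dist_B, of K a'] a' points_B by (metis K)
  then have "A_shift k (B_shift k \<pi>) = shift (letters K a') (shift (letters K b) \<pi>)"
    using ne_B shifts by (simp add: A_shift_def)
  also have "\<dots> = shift (letters K b') (shift (letters K a) \<pi>)"
    using comm by (simp add: shift_def)
  also have "\<dots> = B_shift k (A_shift k \<pi>)"
  proof -
    have "B_seq k (A_shift k \<pi>) = letters K b'"
      using B_seq_eq[OF dist_A, of K b'] b' points_A by (metis K)
    then show ?thesis
      using ne_A shifts by (simp add: B_shift_def)
  qed
  finally show ?thesis
    using ne_A ne_B by blast
qed

end
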